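(* Consider a two-player zero-sum absorbing game $(\Omega,I,J,q,g,g^* )$ together with $\varepsilon\in(0,1/2)$, $x_0\in\Delta(I)$, $\lambda\in(0,1)$, $x_\lambda\in\Delta(I)$ and the functions $g^\sharp,g^\flat:J\to\mathbb{R}$ as specified in the context (including all the standing assumptions there). Let $\mu_t=\varepsilon t^{-3/4}$ for all $t\geq 1$. For $(i_1,j_1,i_2,j_2,\dots)\in(I\times J)^{\mathbb{N}^*}$ and all $t\geq 1$, define recursively $$\tilde R^{(1)}_{t-1}=\max\Big(0,\,-\sum_{s=1}^{t-1}\alpha_sa_sg^\sharp(j_s)\Big),\qquad \tilde R^{(2)}_{t-1}=\max\Big(0,\,\sum_{s=1}^{t-1}\alpha_s(\mu_s^{-1}a_s-1)g^\flat(j_s)\Big),$$ $$\alpha_t=\prod_{s=1}^{t-1}\big(a_sq(\omega|x_\lambda,j_s)+(1-a_s)q(\omega|x_0,j_s)\big),$$ $$a_t=\begin{cases}0&\text{if }\tilde R^{(1)}_{t-1}=\tilde R^{(2)}_{t-1}=0,\\[4pt] \displaystyle\sup_{j\in J,\ g^\flat(j)<0}\frac{\mu_t^2g^\flat(j)\tilde R^{(2)}_{t-1}}{\mu_tg^\flat(j)\tilde R^{(2)}_{t-1}-g^\sharp(j)\tilde R^{(1)}_{t-1}}&\text{otherwise,}\end{cases}$$ so that $a_t$ is a function of $(i_1,j_1,\dots,i_{t-1},j_{t-1})$, and let $\sigma=(\sigma_t)_{t\geq 1}$ be the strategy of Player I given by $$\sigma_t(i_1,j_1,\dots,i_{t-1},j_{t-1})=a_tx_\lambda+(1-a_t)x_0,\qquad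 t\geq 1.$$ Then $\sigma$ guarantees that for all $\tau\in\mathcal{T}$ and all $T\geq 256\,\lambda^{-4}\varepsilon^{-12}$, $$\gamma_T(\sigma,\tau)\geq-8\varepsilon.$$
   Context: For a compact or measurable space $A$, $\Delta(A)$ denotes the set of probability distributions over $A$, equipped with the weak topology when $A$ is compact. Absorbing game. A two-player zero-sum absorbing game is a tuple $(\Omega,I,J,q,g,g^* )$ where: the state space is $\Omega=\Omega^*\cup\{\omega\}$, with $\Omega^*$ a finite set of absorbing states and $\omega\notin\Omega^*$ the unique non-absorbing state; $I$ and $J$ are compact topological spaces, the pure action sets of Players I and II; $q:I\times J\to\Delta(\Omega)$ is separately continuous ($q(\omega'|i,j)$ denotes the weight of $q(i,j)$ on $\omega'\in\Omega$); $g:I\times J\to\mathbb{R}$ is separately continuous and bounded; $g^*:\Omega\to\mathbb{R}$. Both $g$ and $q$ are extended linearly to $\Delta(I)\times J$, e.g. $g(x,j)=\int_Ig(i,j)\,dx(i)$. Strategies. A behavior strategy of Player I is a sequence $\sigma=(\sigma_t)_{t\geq1}$ of measurable maps $\sigma_t:(I\times J)^{t-1}\to\Delta(I)$; a behavior strategy of Player II is a sequence $\tau=(\tau_t)_{t\geq 1}$ of measurable maps $\tau_t:(I\times J)^{t-1}\to\Delta(J)$. Their sets are $\Sigma$ and $\mathcal{T}$. A stationary strategy of Player I plays a fixed $x\in\Delta(I)$ at every stage. A pair $(\sigma,\tau)$ induces a probability $\mathbb{P}_{\sigma,\tau}$ (expectation $\mathbb{E}_{\sigma,\tau}$) on plays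 $(\omega_1,i_1,j_1,\omega_2,i_2,j_2,\dots)$ such that $\omega_1=\omega$ and, for $t\geq1$ and $h_{t-1}=(i_1,j_1,\dots,i_{t-1},j_{t-1})$: conditionally on $h_{t-1}$, $i_t$ and $j_t$ are independent with laws $\sigma_t(h_{t-1})$ and $\tau_t(h_{t-1})$; and $\omega_{t+1}=\omega_t$ if $\omega_t\in\Omega^*$, while $\omega_{t+1}\sim q(i_t,j_t)$ if $\omega_t=\omega$. The stage payoff is $g_t=g(i_t,j_t)$ if $\omega_t=\omega$ and $g_t=g^*(\omega_t)$ if $\omega_t\in\Omega^*$. For $T\geq1$ and $\lambda\in(0,1)$, $\gamma_T(\sigma,\tau)=\mathbb{E}_{\sigma,\tau}\big[\frac1T\sum_{t=1}^Tg_t\big]$ and $\gamma_\lambda(\sigma,\tau)=\mathbb{E}_{\sigma,\tau}\big[\sum_{t\geq1}\lambda(1-\lambda)^{t-1}g_t\big]$. The discounted value $v_\lambda=\max_{\sigma\in\Sigma}\min_{\tau\in\mathcal{T}}\gamma_\lambda(\sigma,\tau)=\min_{\tau\in\mathcal{T}}\max_{\sigma\in\Sigma}\gamma_\lambda(\sigma,\tau)$ is known to exist, and Player I is known to have an optimal stationary strategy in the $\lambda$-discounted game, i.e. one reaching the left-hand maximum. Standing assumptions. $\varepsilon\in(0,1/2)$ is fixed; $\limsup_{\lambda\to0^+}v_\lambda=\varepsilon$, $\|g\|_\infty\leq1$, $\|g^*\|_\infty\leq1$. For each $\lambda\in(0,1)$, $x_\lambda\in\Delta(I)$ is an optimal stationary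 strategy of Player I in the $\lambda$-discounted game. $(\lambda_k)_{k\geq1}$ is a sequence in $(0,1)$ with $\lambda_k\to0$, $v_{\lambda_k}\to\limsup_{\lambda\to0^+}v_\lambda$, and $x_{\lambda_k}\to x_0$ for some $x_0\in\Delta(I)$. From now on $\lambda\in(0,1)$ is a fixed number such that for all $j\in J$, $|g(x_0,j)-g(x_\lambda,j)|\leq\varepsilon/2$, and $v_\lambda\geq\varepsilon/2$. For $j\in J$, $g^\sharp(j):=\sum_{\omega^*\in\Omega^*}g^*(\omega^* )\,q(\omega^*|x_\lambda,j)$ and $g^\flat(j):=g(x_0,j)$. It is assumed that there exists $j\in J$ with $g^\flat(j)<0$. *)

theory Defs
  imports "HOL-Probability.Probability"
begin

text \<open>
  The finite type \<open>'w\<close> is \<open>\<Omega>\<close>; the absorbing states are all its elements except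
  \<open>nonabs G\<close>, which is \<open>\<omega>\<close>. The types \<open>'i\<close> and \<open>'j\<close> are the action spaces \<open>I\<close> and \<open>J\<close>.
\<close>

record ('w, 'i, 'j) absorbing_game =
  nonabs :: 'w
  trans :: "'i \<Rightarrow> 'j \<Rightarrow> 'w pmf"
  pay :: "'i \<Rightarrow> 'j \<Rightarrow> real"
  abs_pay :: "'w \<Rightarrow> real"

text \<open>
  The last two clauses are what makes the transition law and the stage payoff measurable in the
  pair of actions, so that the law of the play exists. For compact metrizable action spaces they
  follow from separate continuity; for arbitrary compact spaces they do not.
\<close>

definition is_absorbing_game ::
  "('w::finite, 'i::topological_space, 'j::topological_space) absorbing_game \<Rightarrow> bool" where
  "is_absorbing_game G \<longleftrightarrow>
     compact (UNIV :: 'i set) \<and> compact (UNIV :: 'j set) \<and>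
     (\<forall>w j. continuous_on UNIV (\<lambda>i. pmf (trans G i j) w)) \<and>
     (\<forall>w i. continuous_on UNIV (\<lambda>j. pmf (trans G i j) w)) \<and>
     (\<forall>j. continuous_on UNIV (\<lambda>i. pay G i j)) \<and>
     (\<forall>i. continuous_on UNIV (\<lambda>j. pay G i j)) \<and>
     bounded (range (\<lambda>(i, j). pay G i j)) \<and>
     (\<forall>w. (\<lambda>(i, j). pmf (trans G i j) w) \<in> borel_measurable (borel \<Otimes>\<^sub>M borel)) \<and>
     (\<lambda>(i, j). pay G i j) \<in> borel_measurable (borel \<Otimes>\<^sub>M borel)"

abbreviation Delta :: "'a::topological_space measure set" where
  "Delta \<equiv> space (prob_algebra borel)"

definition weakly_converges ::
  "(nat \<Rightarrow> 'a::topological_space measure) \<Rightarrow> 'a measure \<Rightarrow> bool" where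
  "weakly_converges M N \<longleftrightarrow>
     (\<forall>f :: 'a \<Rightarrow> real. continuous_on UNIV f \<longrightarrow> bounded (range f) \<longrightarrow>
        (\<lambda>n. \<integral>a. f a \<partial>M n) \<longlonglongrightarrow> (\<integral>a. f a \<partial>N))"

definition mixed_pay :: "('w, 'i, 'j) absorbing_game \<Rightarrow> 'i measure \<Rightarrow> 'j \<Rightarrow> real" where
  "mixed_pay G x j = (\<integral>i. pay G i j \<partial>x)"

definition mixed_trans :: "('w, 'i, 'j) absorbing_game \<Rightarrow> 'w \<Rightarrow> 'i measure \<Rightarrow> 'j \<Rightarrow> real" where
  "mixed_trans G w x j = (\<integral>i. pmf (trans G i j) w \<partial>x)"

text \<open>
  Stages are counted from 0: index \<open>n\<close> is stage \<open>n + 1\<close>. A history before stage \<open>n + 1\<close> is an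
  extensional function on \<open>{0..<n}\<close> whose value at \<open>s\<close> is the pair of actions of stage \<open>s + 1\<close>.
\<close>

abbreviation history_space ::
  "nat \<Rightarrow> (nat \<Rightarrow> 'i::topological_space \<times> 'j::topological_space) measure" where
  "history_space n \<equiv> PiM {0..<n} (\<lambda>_. borel \<Otimes>\<^sub>M borel)"

type_synonym ('i, 'j, 'a) strategy = "nat \<Rightarrow> (nat \<Rightarrow> 'i \<times> 'j) \<Rightarrow> 'a measure"

definition behavior_strategies ::
  "('i::topological_space, 'j::topological_space, 'a::topological_space) strategy set" where
  "behavior_strategies = {\<sigma>. \<forall>n. \<sigma> n \<in> measurable (history_space n) (prob_algebra borel)}"

definition stationary :: "'a measure \<Rightarrow> ('i, 'j, 'a) strategy" where
  "stationary x = (\<lambda>n h. x)"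

text \<open>
  A play assigns to \<open>n\<close> the triple \<open>(\<omega>\<^sub>n\<^sub>+\<^sub>1, i\<^sub>n\<^sub>+\<^sub>1, j\<^sub>n\<^sub>+\<^sub>1)\<close>. Given the play up to stage \<open>n\<close>, the
  next state depends on the last stage only, the actions on the history of actions only, and
  these three components are independent.
\<close>

definition stage_space ::
  "('w \<times> 'i::topological_space \<times> 'j::topological_space) measure" where
  "stage_space = count_space UNIV \<Otimes>\<^sub>M (borel \<Otimes>\<^sub>M borel)"

definition next_state ::
  "('w, 'i, 'j) absorbing_game \<Rightarrow> nat \<Rightarrow> (nat \<Rightarrow> 'w \<times> 'i \<times> 'j) \<Rightarrow> 'w pmf" where
  "next_state G n p =
     (case n of
        0 \<Rightarrow> return_pmf (nonabs G)
      | Suc m \<Rightarrow> (case p m of (w, i, j) \<Rightarrow>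
          if w = nonabs G then trans G i j else return_pmf w))"

definition actions :: "nat \<Rightarrow> (nat \<Rightarrow> 'w \<times> 'i \<times> 'j) \<Rightarrow> nat \<Rightarrow> 'i \<times> 'j" where
  "actions n p = restrict (\<lambda>s. snd (p s)) {0..<n}"

definition stage_law ::
  "('w, 'i, 'j) absorbing_game \<Rightarrow> ('i, 'j, 'i) strategy \<Rightarrow> ('i, 'j, 'j) strategy \<Rightarrow>
   nat \<Rightarrow> (nat \<Rightarrow> 'w \<times> 'i \<times> 'j) \<Rightarrow> ('w \<times> 'i \<times> 'j) measure" where
  "stage_law G \<sigma> \<tau> n p =
     measure_pmf (next_state G n p) \<Otimes>\<^sub>M (\<sigma> n (actions n p) \<Otimes>\<^sub>M \<tau> n (actions n p))"

text \<open>The projective limit given by the Ionescu-Tulcea theorem for the kernels \<open>stage_law G \<sigma> \<tau>\<close>.\<close>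

definition play_measure ::
  "('w, 'i::topological_space, 'j::topological_space) absorbing_game \<Rightarrow>
   ('i, 'j, 'i) strategy \<Rightarrow> ('i, 'j, 'j) strategy \<Rightarrow> (nat \<Rightarrow> 'w \<times> 'i \<times> 'j) measure" where
  "play_measure G \<sigma> \<tau> =
     projective_family.lim UNIV
       (Ionescu_Tulcea.CI (stage_law G \<sigma> \<tau>) (\<lambda>_. stage_space)) (\<lambda>_. stage_space)"

definition stage_payoff :: "('w, 'i, 'j) absorbing_game \<Rightarrow> 'w \<times> 'i \<times> 'j \<Rightarrow> real" where
  "stage_payoff G = (\<lambda>(w, i, j). if w = nonabs G then pay G i j else abs_pay G w)"

definition gamma_T ::
  "('w, 'i::topological_space, 'j::topological_space) absorbing_game \<Rightarrow> nat \<Rightarrow>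
   ('i, 'j, 'i) strategy \<Rightarrow> ('i, 'j, 'j) strategy \<Rightarrow> real" where
  "gamma_T G T \<sigma> \<tau> =
     (\<integral>p. (1 / real T) * (\<Sum>n<T. stage_payoff G (p n)) \<partial>play_measure G \<sigma> \<tau>)"

definition gamma_disc ::
  "('w, 'i::topological_space, 'j::topological_space) absorbing_game \<Rightarrow> real \<Rightarrow>
   ('i, 'j, 'i) strategy \<Rightarrow> ('i, 'j, 'j) strategy \<Rightarrow> real" where
  "gamma_disc G l \<sigma> \<tau> =
     (\<integral>p. (\<Sum>n. l * (1 - l) ^ n * stage_payoff G (p n)) \<partial>play_measure G \<sigma> \<tau>)"

definition disc_value ::
  "('w, 'i::topological_space, 'j::topological_space) absorbing_game \<Rightarrow> real \<Rightarrow> real" where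
  "disc_value G l =
     (SUP \<sigma>\<in>behavior_strategies. INF \<tau>\<in>behavior_strategies. gamma_disc G l \<sigma> \<tau>)"

definition optimal_stationary ::
  "('w, 'i::topological_space, 'j::topological_space) absorbing_game \<Rightarrow> real \<Rightarrow>
   'i measure \<Rightarrow> bool" where
  "optimal_stationary G l x \<longleftrightarrow>
     x \<in> Delta \<and> (INF \<tau>\<in>behavior_strategies. gamma_disc G l (stationary x) \<tau>) = disc_value G l"

definition g_sharp :: "('w::finite, 'i, 'j) absorbing_game \<Rightarrow> 'i measure \<Rightarrow> 'j \<Rightarrow> real" where
  "g_sharp G xl j = (\<Sum>w\<in>UNIV - {nonabs G}. abs_pay G w * mixed_trans G w xl j)"

definition g_flat :: "('w, 'i, 'j) absorbing_game \<Rightarrow> 'i measure \<Rightarrow> 'j \<Rightarrow> real" where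
  "g_flat G x0 j = mixed_pay G x0 j"

definition mu :: "real \<Rightarrow> nat \<Rightarrow> real" where
  "mu e n = e * real (Suc n) powr (- 3 / 4)"

text \<open>
  \<open>alpha_seq G e xl x0 h n\<close>, \<open>a_seq G e xl x0 h n\<close> are \<open>\<alpha>\<^sub>n\<^sub>+\<^sub>1\<close>, \<open>a\<^sub>n\<^sub>+\<^sub>1\<close>, and \<open>R1_seq G e xl x0 h n\<close>,
  \<open>R2_seq G e xl x0 h n\<close> are the two regrets after \<open>n\<close> stages.
\<close>

context
  fixes G :: "('w::finite, 'i, 'j) absorbing_game" and e :: real
    and xl x0 :: "'i measure" and h :: "nat \<Rightarrow> 'i \<times> 'j"
begin

function alpha_seq :: "nat \<Rightarrow> real" and a_seq :: "nat \<Rightarrow> real"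
  and R1_seq :: "nat \<Rightarrow> real" and R2_seq :: "nat \<Rightarrow> real" where
  "alpha_seq n =
     (\<Prod>s<n. a_seq s * mixed_trans G (nonabs G) xl (snd (h s))
            + (1 - a_seq s) * mixed_trans G (nonabs G) x0 (snd (h s)))"
| "R1_seq n = max 0 (- (\<Sum>s<n. alpha_seq s * a_seq s * g_sharp G xl (snd (h s))))"
| "R2_seq n = max 0 (\<Sum>s<n. alpha_seq s * (inverse (mu e s) * a_seq s - 1) * g_flat G x0 (snd (h s)))"
| "a_seq n =
     (if R1_seq n = 0 \<and> R2_seq n = 0 then 0
      else SUP j\<in>{j. g_flat G x0 j < 0}.
        ((mu e n)\<^sup>2 * g_flat G x0 j * R2_seq n)
        / (mu e n * g_flat G x0 j * R2_seq n - g_sharp G xl j * R1_seq n))"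
  by pat_completeness auto
termination
  by (relation "inv_image less_than (case_sum (case_sum (\<lambda>n. 2 * n) (\<lambda>n. 2 * n + 1))
                                             (case_sum (\<lambda>n. 2 * n) (\<lambda>n. 2 * n)))") auto

end

definition convex_comb :: "real \<Rightarrow> 'a measure \<Rightarrow> 'a measure \<Rightarrow> 'a measure" where
  "convex_comb a M N =
     measure_of (space M) (sets M) (\<lambda>A. ennreal a * emeasure M A + ennreal (1 - a) * emeasure N A)"

definition sigma_star ::
  "('w::finite, 'i, 'j) absorbing_game \<Rightarrow> real \<Rightarrow> 'i measure \<Rightarrow> 'i measure \<Rightarrow>
   ('i, 'j, 'i) strategy" where
  "sigma_star G e xl x0 n h = convex_comb (a_seq G e xl x0 h n) xl x0"

end

(*
  Under the optimal stationary strategy x_lam, a pure reply j gives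
  (1 - lam) g#(j) + lam gflat(j) >= 0, and absorption under the limit x_0 is never unfavourable. So a
  small weight a_t on x_lam trades the non-absorbing payoff against the absorbing one, and the choice
  of a_t makes the two regrets satisfy Blackwell's condition for the scalar product with weights
  1 and mu_t^2. Hence R1^2 + mu_t^2 R2^2 <= 2 sum mu_s^2 <= 6 eps^2 along every sequence of actions
  of Player II. Where gflat(j) < 0, lam |gflat(j)| <= g#(j) is at most the absorption probability
  under x_lam, so the flat payoffs that are weighted by a_t / mu_t sum up to at most T^(3/4) / (eps lam).

  To pass from action sequences to expectations, all payoffs are shifted by 1, and the law of the
  play is reweighted by the likelihood ratio of the actions given non-absorption.
*)

theory Submission
  imports Defs
begin

section \<open>Regret bounds along a sequence of actions\<close>

text \<open>The supremum in \<open>a_seq\<close> is a closed formula in disguise. Let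
  \<open>\<kappa>\<close> be the infimum of g#(j) / (-gflat(j)) over gflat(j) < 0. Then g# +
  \<open>\<kappa>\<close> gflat >= 0 for every j, also where gflat >= 0, because
  \<open>\<kappa>\<close> is at least lam / (1 - lam). The supremum equals mu^2 R2 / (mu R2 +
  \<open>\<kappa>\<close> R1), which is the weight for which the multiples of gflat(j) cancel in
  Blackwell's condition, whatever its sign. The formula also gives a <= mu and,
  \<open>\<kappa>\<close> being one number, the measurability of the strategy. The exponent 3/4
  meets two needs: the squares of mu must be summable, to bound the potential, and 1 / mu must be
  o(T), to make R2 / T and the flat loss vanish. The threshold on T is the fourth power of 4 / (lam
  eps^3), a lower bound on T^(1/4) that makes T^(3/4) / (eps lam) a small multiple of eps T. The
  shift by 1 makes payoffs nonnegative, so that expectations are \<open>nn_integral\<close>s: sums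
  and integrals can be exchanged freely, and an inequality suffices in the change of measure. The
  shift contributes exactly T to the total.\<close>

lemma sum_powr_three_halves_le: "(\<Sum>s<n. real (Suc s) powr (- 3 / 2)) \<le> 3"
proof -
  \<comment> \<open>Comparison with the integral of u powr (-3/2) from n to n + 1, done
    algebraically. It needs n > 0, so the first term 1 is kept apart: 3 = 1 + 2.\<close>
  have step: "real (Suc n) powr (- 3 / 2) \<le> 2 / sqrt n - 2 / sqrt (Suc n)" if "n > 0" for n :: nat
  proof -
    define x y where "x = sqrt n" and "y = sqrt (Suc n)"
    have pos: "x > 0" "y > 0" "x \<le> y" and sq: "x\<^sup>2 = n" "y\<^sup>2 = Suc n"
      using that by (auto simp: x_def y_def)
    have "real (Suc n) powr (- 3 / 2) = (y powr 2) powr (- 3 / 2)"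
      using sq pos by simp
    also have "\<dots> = y powr - 3"
      by (simp only: powr_powr) simp
    also have "\<dots> = 1 / y ^ 3"
      using pos by (simp add: powr_minus_divide)
    also have "\<dots> \<le> 2 / (x * y * (x + y))"
    proof -
      have "x * (x + y) \<le> y * (y + y)"
        using pos by (intro mult_mono) auto
      then have "x * y * (x + y) \<le> 2 * y ^ 3"
        using pos mult_left_mono[of "x * (x + y)" "y * (y + y)" y]
        by (simp add: power3_eq_cube algebra_simps)
      then show ?thesis
        using pos by (simp add: divide_le_eq le_divide_eq mult_ac)
    qed
    also have "\<dots> = 2 * (y\<^sup>2 - x\<^sup>2) / (x * y * (x + y))"
      by (simp add: sq)
    also have "\<dots> = 2 / x - 2 / y"
    proof -
      have "x + y \<noteq> 0"
        using pos by simp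
      then show ?thesis
        using pos by (simp add: divide_simps) (simp add: power2_eq_square algebra_simps)
    qed
    finally show ?thesis
      by (simp add: x_def y_def)
  qed
  have "(\<Sum>s<Suc m. real (Suc s) powr (- 3 / 2)) \<le> 3 - 2 / sqrt (Suc m)" for m
  proof (induction m)
    case (Suc m)
    then show ?case
      using step[of "Suc m"] by simp
  qed simp
  then have "(\<Sum>s<Suc m. real (Suc s) powr (- 3 / 2)) \<le> 3" for m
    by (rule order_trans) simp
  then show ?thesis
    by (cases n) auto
qed

text \<open>The term \<open>u s\<close> lies in the partial sums of the T - 1 - s later indices.
  This is how an absorption at index s is paid at all remaining stages. The type is general because
  both \<open>real\<close> and \<open>ennreal\<close> instances occur.\<close>

lemma sum_weighted_eq_sum_partial_sums:
  fixes u :: "nat \<Rightarrow> 'a::comm_semiring_1"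
  shows "(\<Sum>t<T. of_nat (T - 1 - t) * u t) = (\<Sum>t<T. \<Sum>s<t. u s)"
proof (induction T)
  case (Suc T)
  have "(\<Sum>t<Suc T. of_nat (Suc T - 1 - t) * u t) = (\<Sum>t<T. of_nat (Suc (T - 1 - t)) * u t)"
  proof -
    have "Suc T - 1 - t = Suc (T - 1 - t)" if "t < T" for t
      using that by simp
    then have "(\<Sum>t<T. of_nat (Suc T - 1 - t) * u t) = (\<Sum>t<T. of_nat (Suc (T - 1 - t)) * u t)"
      by (intro sum.cong refl) (simp only: lessThan_iff)
    then show ?thesis
      by simp
  qed
  also have "\<dots> = (\<Sum>t<T. u t) + (\<Sum>t<T. of_nat (T - 1 - t) * u t)"
    by (simp add: distrib_right sum.distrib del: of_nat_diff)
  finally show ?case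
    using Suc by (simp add: add.commute)
qed simp

text \<open>The projection step of Blackwell's argument: truncating the old sum at 0 before adding
  the increment can only enlarge the squared positive part.\<close>

lemma max_0_add_squared_le: "(max 0 (s + u))\<^sup>2 \<le> (max 0 s + u)\<^sup>2" for s u :: real
proof (cases "s + u \<le> 0")
  case False
  then have "0 \<le> max 0 (s + u)" "max 0 (s + u) \<le> max 0 s + u"
    by auto
  then show ?thesis
    by (intro power_mono) auto
qed simp

section \<open>Step sizes and the deterministic regret process\<close>

lemma mu_pos: "0 < e \<Longrightarrow> 0 < mu e n"
  by (simp add: mu_def)

lemma mu_le: "0 < e \<Longrightarrow> mu e n \<le> e"
  using powr_mono2'[of "- 3 / 4" 1 "real (Suc n)"] mult_left_mono[of "real (Suc n) powr (- 3 / 4)" 1 e]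
  by (simp add: mu_def)

lemma mu_antimono: "0 < e \<Longrightarrow> m \<le> n \<Longrightarrow> mu e n \<le> mu e m"
  unfolding mu_def by (intro mult_left_mono powr_mono2') auto

lemma mu_squared: "(mu e n)\<^sup>2 = e\<^sup>2 * real (Suc n) powr (- 3 / 2)"
  by (simp add: mu_def power_mult_distrib powr_power)

text \<open>Only real sequences along one sequence of replies of Player II remain. At each index
  \<open>gs\<close> and \<open>gl\<close> are the absorbing and the stage payoff under x_lam,
  \<open>g0\<close> and \<open>gf\<close> those under x0, while \<open>Q1\<close> and
  \<open>Q0\<close> are the probabilities of not being absorbed under x_lam and x0. The weight
  \<open>a\<close> is given by its closed form instead of the supremum.\<close>

locale regret_path =
  fixes e lam \<kappa> :: real
    and gs gf gl g0 Q1 Q0 \<alpha> a R1 R2 :: "nat \<Rightarrow> real"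
  assumes e: "0 < e" "e < 1 / 2" and lam: "0 < lam" "lam < 1" and \<kappa>: "lam \<le> \<kappa>"
    and Q1: "\<And>n. 0 \<le> Q1 n" "\<And>n. Q1 n \<le> 1" and Q0: "\<And>n. 0 \<le> Q0 n" "\<And>n. Q0 n \<le> 1"
    and gs_le: "\<And>n. \<bar>gs n\<bar> \<le> 1 - Q1 n" and gf_le: "\<And>n. \<bar>gf n\<bar> \<le> 1"
    and g0_ge: "\<And>n. 0 \<le> g0 n" and gl_ge: "\<And>n. gf n - e / 2 \<le> gl n"
    and gs_gf: "\<And>n. 0 \<le> gs n + \<kappa> * gf n"
    and \<alpha>: "\<And>n. \<alpha> n = (\<Prod>s<n. a s * Q1 s + (1 - a s) * Q0 s)"
    and R1: "\<And>n. R1 n = max 0 (- (\<Sum>s<n. \<alpha> s * a s * gs s))"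
    and R2: "\<And>n. R2 n = max 0 (\<Sum>s<n. \<alpha> s * (inverse (mu e s) * a s - 1) * gf s)"
    and a: "\<And>n. a n = (mu e n)\<^sup>2 * R2 n / (mu e n * R2 n + \<kappa> * R1 n)"
begin

lemma R_nonneg: "0 \<le> R1 n" "0 \<le> R2 n"
  by (simp_all add: R1 R2)

lemma a_nonneg: "0 \<le> a n"
  using R_nonneg[of n] mu_pos[OF e(1), of n] \<kappa> lam unfolding a by auto

text \<open>The denominator is at least mu R2. The bound puts
  \<open>inverse (mu e n) * a n - 1\<close> between -1 and 0 and makes the increments of
  \<open>R1\<close> at most mu.\<close>

lemma a_le_mu: "a n \<le> mu e n"
proof (cases "mu e n * R2 n + \<kappa> * R1 n = 0")
  case True
  show ?thesis
    unfolding a True using mu_pos[OF e(1), of n] by simp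
next
  case False
  moreover have "0 \<le> mu e n * R2 n" "0 \<le> \<kappa> * R1 n"
    using R_nonneg[of n] mu_pos[OF e(1), of n] \<kappa> lam by auto
  ultimately have "0 < mu e n * R2 n + \<kappa> * R1 n"
    by linarith
  moreover have "(mu e n)\<^sup>2 * R2 n \<le> mu e n * (mu e n * R2 n + \<kappa> * R1 n)"
    using R_nonneg[of n] mu_pos[OF e(1), of n] \<kappa> lam by (simp add: power2_eq_square algebra_simps)
  ultimately show ?thesis
    unfolding a by (simp add: pos_divide_le_eq)
qed

lemma a_le_1: "a n \<le> 1"
  using a_le_mu[of n] mu_le[OF e(1), of n] e by simp

lemma survival_bounds: "0 \<le> a n * Q1 n + (1 - a n) * Q0 n"
  "a n * Q1 n + (1 - a n) * Q0 n \<le> 1 - a n * (1 - Q1 n)"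
  "a n * Q1 n + (1 - a n) * Q0 n \<le> 1"
proof -
  show "0 \<le> a n * Q1 n + (1 - a n) * Q0 n"
    using a_nonneg[of n] a_le_1[of n] Q1[of n] Q0[of n] by simp
  have "(1 - a n) * Q0 n \<le> (1 - a n) * 1"
    using a_le_1[of n] Q0[of n] by (intro mult_left_mono) auto
  then show *: "a n * Q1 n + (1 - a n) * Q0 n \<le> 1 - a n * (1 - Q1 n)"
    by (simp add: algebra_simps)
  have "0 \<le> a n * (1 - Q1 n)"
    using a_nonneg[of n] Q1[of n] by simp
  with * show "a n * Q1 n + (1 - a n) * Q0 n \<le> 1"
    by simp
qed

lemma \<alpha>_Suc: "\<alpha> (Suc n) = \<alpha> n * (a n * Q1 n + (1 - a n) * Q0 n)"
  by (simp add: \<alpha>)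

lemma \<alpha>_bounds: "0 \<le> \<alpha> n" "\<alpha> n \<le> 1"
  unfolding \<alpha> using survival_bounds by (auto intro!: prod_nonneg prod_le_1)

text \<open>Absorption caused by x_lam alone is at most the total absorption of the stage. The right
  side telescopes to at most 1, a budget from which the loss in the flat payoffs is paid.\<close>

lemma absorption_le: "\<alpha> n * a n * (1 - Q1 n) \<le> \<alpha> n - \<alpha> (Suc n)"
  using mult_left_mono[OF survival_bounds(2)[of n] \<alpha>_bounds(1)[of n]]
  by (simp add: \<alpha>_Suc algebra_simps)

text \<open>
  The potential \<open>R1\<^sup>2 + \<mu>\<^sup>2 R2\<^sup>2\<close> uses the weight for which the weighted scalar product of the regret
  with the stage increment is nonpositive. As \<open>\<mu>\<close> decreases, the change of weight only helps.
\<close>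

lemma blackwell_condition:
  "R1 n * (- (\<alpha> n * a n * gs n))
     + (mu e n)\<^sup>2 * (R2 n * (\<alpha> n * (inverse (mu e n) * a n - 1) * gf n)) \<le> 0"
proof -
  let ?m = "mu e n"
  have m: "?m > 0"
    using mu_pos e by simp
  let ?D = "?m * R2 n + \<kappa> * R1 n"
  have pos: "0 \<le> ?m * R2 n" "0 \<le> \<kappa> * R1 n" "\<kappa> > 0"
    using R_nonneg[of n] m \<kappa> lam by auto
  have "a n * (?m * R2 n * gf n - R1 n * gs n) \<le> ?m\<^sup>2 * R2 n * gf n"
  proof (cases "?D = 0")
    case True
    then have "?m * R2 n = 0"
      using pos by linarith
    then have "R2 n = 0"
      using m by simp
    then show ?thesis
      by (simp add: a)
  next
    case False
    then have D: "?D > 0"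
      using pos by linarith
    \<comment> \<open>The inequality \<open>gs_gf\<close> is multiplied by \<open>R1\<close>, never
      by \<open>gf\<close>, so the sign of \<open>gf\<close> does not matter. It makes
      \<open>gf\<close> a common factor of the denominator \<open>?D\<close>, and
      \<open>a n * ?D\<close> is mu^2 R2 by the choice of \<open>a\<close>.\<close>
    have "R1 n * (- gs n) \<le> R1 n * (\<kappa> * gf n)"
      using gs_gf[of n] R_nonneg by (intro mult_left_mono) auto
    then have "?m * R2 n * gf n - R1 n * gs n \<le> gf n * ?D"
      by (simp add: algebra_simps)
    then have "a n * (?m * R2 n * gf n - R1 n * gs n) \<le> a n * (gf n * ?D)"
      using a_nonneg by (rule mult_left_mono)
    also have "\<dots> = ?m\<^sup>2 * R2 n * gf n"
      using D unfolding a by simp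
    finally show ?thesis .
  qed
  then have "\<alpha> n * (a n * (?m * R2 n * gf n - R1 n * gs n)) \<le> \<alpha> n * (?m\<^sup>2 * R2 n * gf n)"
    using \<alpha>_bounds(1) by (rule mult_left_mono)
  then show ?thesis
    using m by (simp add: algebra_simps power2_eq_square)
qed

lemma increment_bounds:
  "\<bar>\<alpha> n * a n * gs n\<bar> \<le> mu e n" "\<bar>\<alpha> n * (inverse (mu e n) * a n - 1) * gf n\<bar> \<le> 1"
proof -
  have m: "mu e n > 0"
    using mu_pos e by simp
  have "\<bar>gs n\<bar> \<le> 1"
    using gs_le[of n] Q1[of n] by linarith
  then have "(\<alpha> n * a n) * \<bar>gs n\<bar> \<le> (1 * mu e n) * 1"
    using \<alpha>_bounds[of n] a_nonneg[of n] a_le_mu[of n] m by (intro mult_mono) auto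
  then show "\<bar>\<alpha> n * a n * gs n\<bar> \<le> mu e n"
    using \<alpha>_bounds[of n] a_nonneg[of n] by (simp add: abs_mult)
  have "0 \<le> inverse (mu e n) * a n" "inverse (mu e n) * a n \<le> 1"
    using m a_nonneg[of n] a_le_mu[of n] by (auto simp: field_simps)
  then have "\<alpha> n * \<bar>inverse (mu e n) * a n - 1\<bar> * \<bar>gf n\<bar> \<le> 1 * 1 * 1"
    using \<alpha>_bounds[of n] gf_le[of n] by (intro mult_mono) auto
  then show "\<bar>\<alpha> n * (inverse (mu e n) * a n - 1) * gf n\<bar> \<le> 1"
    using \<alpha>_bounds[of n] by (simp add: abs_mult)
qed

text \<open>Expanding the squares leaves a cross term that \<open>blackwell_condition\<close> makes
  nonpositive. The squared increments are at most mu^2 for the first regret and 1 for the second;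
  the weight mu^2 brings the latter to the same size. With the sum of squares at most 3 e^2 the
  constant is 2 * 3.\<close>

lemma potential_le: "(R1 n)\<^sup>2 + (mu e n)\<^sup>2 * (R2 n)\<^sup>2 \<le> 6 * e\<^sup>2"
proof -
  have "(R1 n)\<^sup>2 + (mu e n)\<^sup>2 * (R2 n)\<^sup>2 \<le> 2 * (\<Sum>s<n. (mu e s)\<^sup>2)"
  proof (induction n)
    case 0
    then show ?case
      by (simp add: R1 R2)
  next
    case (Suc n)
    let ?m = "mu e n"
    define u1 where "u1 = - (\<alpha> n * a n * gs n)"
    define u2 where "u2 = \<alpha> n * (inverse ?m * a n - 1) * gf n"
    have "\<bar>u1\<bar> \<le> \<bar>?m\<bar>" "\<bar>u2\<bar> \<le> \<bar>1\<bar>"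
      using increment_bounds[of n] by (auto simp: u1_def u2_def)
    then have u: "u1\<^sup>2 \<le> ?m\<^sup>2" "u2\<^sup>2 \<le> 1\<^sup>2"
      by (simp_all only: abs_le_square_iff)
    have "(R1 (Suc n))\<^sup>2 \<le> (R1 n + u1)\<^sup>2"
      using max_0_add_squared_le[of "- (\<Sum>s<n. \<alpha> s * a s * gs s)" u1]
      by (simp add: R1[of "Suc n"] R1[of n] u1_def algebra_simps)
    moreover have r2: "(R2 (Suc n))\<^sup>2 \<le> (R2 n + u2)\<^sup>2"
      using max_0_add_squared_le[of "\<Sum>s<n. \<alpha> s * (inverse (mu e s) * a s - 1) * gf s" u2]
      by (simp add: R2[of "Suc n"] R2[of n] u2_def)
    moreover have "(mu e (Suc n))\<^sup>2 * (R2 (Suc n))\<^sup>2 \<le> ?m\<^sup>2 * (R2 n + u2)\<^sup>2"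
    proof (rule mult_mono)
      show "(mu e (Suc n))\<^sup>2 \<le> ?m\<^sup>2"
        using mu_antimono[OF e(1), of n "Suc n"] mu_pos[OF e(1), of "Suc n"] by (intro power_mono) auto
    qed (use r2 in auto)
    moreover have "(R1 n + u1)\<^sup>2 + ?m\<^sup>2 * (R2 n + u2)\<^sup>2 =
        ((R1 n)\<^sup>2 + ?m\<^sup>2 * (R2 n)\<^sup>2) + 2 * (R1 n * u1 + ?m\<^sup>2 * (R2 n * u2)) + u1\<^sup>2 + ?m\<^sup>2 * u2\<^sup>2"
      by (simp add: power2_eq_square algebra_simps)
    moreover have "R1 n * u1 + ?m\<^sup>2 * (R2 n * u2) \<le> 0"
      using blackwell_condition[of n] by (simp add: u1_def u2_def)
    moreover have "?m\<^sup>2 * u2\<^sup>2 \<le> ?m\<^sup>2"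
      using u mult_left_mono[of "u2\<^sup>2" 1 "?m\<^sup>2"] by simp
    ultimately have "(R1 (Suc n))\<^sup>2 + (mu e (Suc n))\<^sup>2 * (R2 (Suc n))\<^sup>2
        \<le> ((R1 n)\<^sup>2 + ?m\<^sup>2 * (R2 n)\<^sup>2) + 2 * ?m\<^sup>2"
      using u(1) by argo
    with Suc show ?case
      by simp
  qed
  also have "\<dots> = 2 * (e\<^sup>2 * (\<Sum>s<n. real (Suc s) powr (- 3 / 2)))"
    by (simp only: mu_squared sum_distrib_left)
  also have "\<dots> \<le> 2 * (e\<^sup>2 * 3)"
    using sum_powr_three_halves_le by (intro mult_left_mono) auto
  finally show ?thesis
    by simp
qed

text \<open>The factor 5/2 is a rational upper bound for the square root of 6.\<close>

lemma R1_le: "R1 n \<le> 5 / 2 * e"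
proof (rule power2_le_imp_le)
  have "0 \<le> (mu e n)\<^sup>2 * (R2 n)\<^sup>2" "0 \<le> e\<^sup>2"
    by simp_all
  moreover have "(5 / 2 * e)\<^sup>2 = 25 / 4 * e\<^sup>2"
    by (simp add: power2_eq_square)
  ultimately show "(R1 n)\<^sup>2 \<le> (5 / 2 * e)\<^sup>2"
    using potential_le[of n] by linarith
qed (use e in simp)

lemma R2_le: "R2 n \<le> 5 / 2 * real (Suc n) powr (3 / 4)"
proof -
  have "0 \<le> (R1 n)\<^sup>2" "0 \<le> e\<^sup>2"
    by simp_all
  moreover have "(5 / 2 * e)\<^sup>2 = 25 / 4 * e\<^sup>2"
    by (simp add: power2_eq_square)
  ultimately have "(mu e n * R2 n)\<^sup>2 \<le> (5 / 2 * e)\<^sup>2"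
    using potential_le[of n] unfolding power_mult_distrib by linarith
  then have "mu e n * R2 n \<le> 5 / 2 * e"
    by (rule power2_le_imp_le) (use e in simp)
  then have "e * (real (Suc n) powr (- 3 / 4) * R2 n) \<le> e * (5 / 2)"
    by (simp add: mu_def mult_ac)
  then have "real (Suc n) powr (- 3 / 4) * R2 n \<le> 5 / 2"
    using e mult_le_cancel_left_pos by blast
  then show ?thesis
    by (simp add: powr_minus_divide field_simps)
qed

text \<open>The sum is the expected total payoff when Player II plays a fixed sequence: index t is
  reached unabsorbed with weight \<open>\<alpha> t\<close>, and absorption there is paid at the T -
  1 - t later stages. In multiples of e T the losses are 1/2 for replacing x_lam by x0, 1/8 for the
  flat payoffs charged to absorption, 5/16 for \<open>R2\<close> and 5/2 for \<open>R1\<close>;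
  their sum is well below 8.\<close>

lemma path_payoff_ge:
  assumes T: "256 / (lam ^ 4 * e ^ 12) \<le> real T"
  shows "- 8 * e * real T \<le>
    (\<Sum>t<T. \<alpha> t * (a t * gl t + (1 - a t) * gf t
              + real (T - 1 - t) * (a t * gs t + (1 - a t) * g0 t)))"
proof -
  have "0 < 256 / (lam ^ 4 * e ^ 12)"
    using e lam by simp
  with T have Tpos: "T > 0"
    using of_nat_0_less_iff[where 'a = real] by linarith
  define r where "r = real T powr (1 / 4)"
  define P where "P = real T powr (3 / 4)"
  have "r > 0" "P > 0"
    using Tpos by (simp_all add: r_def P_def)
  have rP: "P * r = real T" and r4: "r ^ 4 = real T"
    using Tpos by (simp_all add: r_def P_def powr_add[symmetric] powr_power)
  \<comment> \<open>The threshold on T is a fourth power, 256 = 4^4, so it becomes linear in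
    \<open>r\<close>; multiplied by \<open>P\<close> it bounds T^(3/4) by a multiple of T.\<close>
  have "(4 / (lam * e ^ 3)) ^ 4 \<le> r ^ 4"
    using T unfolding r4 by (simp add: power_divide power_mult_distrib flip: power_mult)
  then have "4 / (lam * e ^ 3) \<le> r"
    using \<open>r > 0\<close> e lam power_mono_iff[of "4 / (lam * e ^ 3)" r 4] by simp
  then have "4 \<le> r * (lam * e ^ 3)"
    using e lam by (simp add: field_simps)
  then have "P * 4 \<le> P * (r * (lam * e ^ 3))"
    using \<open>P > 0\<close> by (intro mult_left_mono) auto
  then have P_le: "4 * P \<le> real T * (lam * e ^ 3)"
    by (simp add: rP[symmetric] mult_ac)

  \<comment> \<open>Each \<open>gf t\<close> is written as mu^-1 a gf - (mu^-1 a - 1) gf. The second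
    part sums to at most \<open>R2 T\<close>, the first is charged to absorption, and the difference
    \<open>gl t - gf t\<close> costs at most e / 2 per stage.\<close>
  have flat: "(\<Sum>t<T. \<alpha> t * (a t * gl t + (1 - a t) * gf t)) \<ge> - (e / 2) * real T - P / (e * lam) - R2 T"
  proof -
    have "\<alpha> t * (a t * gl t + (1 - a t) * gf t) \<ge>
        - (e / 2) - P / (e * lam) * (\<alpha> t - \<alpha> (Suc t))
        - \<alpha> t * (inverse (mu e t) * a t - 1) * gf t" if "t < T" for t
    proof -
      have m: "mu e t > 0"
        using mu_pos e by simp
      have "a t * (gl t - gf t) \<ge> a t * (- (e / 2))"
        using gl_ge[of t] a_nonneg[of t] by (intro mult_left_mono) auto
      moreover have "a t * (e / 2) \<le> 1 * (e / 2)"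
        using a_le_1[of t] e by (intro mult_right_mono) auto
      ultimately have "a t * (gl t - gf t) \<ge> - (e / 2)"
        by linarith
      then have "\<alpha> t * (a t * (gl t - gf t)) \<ge> \<alpha> t * (- (e / 2))"
        using \<alpha>_bounds by (intro mult_left_mono) auto
      moreover have "\<alpha> t * (e / 2) \<le> 1 * (e / 2)"
        using \<alpha>_bounds[of t] e by (intro mult_right_mono) auto
      ultimately have 1: "\<alpha> t * (a t * (gl t - gf t)) \<ge> - (e / 2)"
        by linarith
      \<comment> \<open>Only negative \<open>gf t\<close> costs anything. Then lam |gf| <=
        \<open>gs t\<close> <= 1 - \<open>Q1 t\<close>, while 1 / mu is at most T^(3/4) / e because
        t < T, and \<open>absorption_le\<close> applies.\<close>
      have 2: "\<alpha> t * (inverse (mu e t) * a t) * gf t \<ge> - (P / (e * lam) * (\<alpha> t - \<alpha> (Suc t)))"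
      proof (cases "gf t < 0")
        case True
        have "lam * (- gf t) \<le> \<kappa> * (- gf t)"
          using \<kappa> True by (intro mult_right_mono) auto
        also have "\<dots> \<le> gs t"
          using gs_gf[of t] by simp
        finally have "lam * (- gf t) \<le> 1 - Q1 t"
          using gs_le[of t] by linarith
        then have gf: "- gf t \<le> (1 - Q1 t) / lam"
          using lam by (simp add: field_simps)
        have mu: "inverse (mu e t) \<le> P / e"
        proof -
          have "inverse (mu e t) = real (Suc t) powr (3 / 4) / e"
            by (simp add: mu_def powr_minus_divide)
          also have "\<dots> \<le> P / e"
            unfolding P_def using that e by (intro divide_right_mono powr_mono2) auto
          finally show ?thesis .
        qed
        have "\<alpha> t * (inverse (mu e t) * a t) * (- gf t)
            \<le> \<alpha> t * (P / e * a t) * ((1 - Q1 t) / lam)"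
          using gf mu True \<alpha>_bounds[of t] a_nonneg[of t] m \<open>P > 0\<close> e
          by (intro mult_mono) auto
        also have "\<dots> = P / (e * lam) * (\<alpha> t * a t * (1 - Q1 t))"
          by simp
        also have "\<dots> \<le> P / (e * lam) * (\<alpha> t - \<alpha> (Suc t))"
          using absorption_le[of t] \<open>P > 0\<close> e lam by (intro mult_left_mono) auto
        finally show ?thesis
          by simp
      next
        case False
        have "\<alpha> (Suc t) \<le> \<alpha> t * 1"
          unfolding \<alpha>_Suc using survival_bounds \<alpha>_bounds by (intro mult_left_mono) auto
        then have "0 \<le> P / (e * lam) * (\<alpha> t - \<alpha> (Suc t))"
          using \<open>P > 0\<close> e lam by simp
        moreover have "0 \<le> \<alpha> t * (inverse (mu e t) * a t) * gf t"
          using False \<alpha>_bounds[of t] a_nonneg[of t] m by simp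
        ultimately show ?thesis
          by linarith
      qed
      from 1 2 show ?thesis
        by (simp add: algebra_simps)
    qed
    then have "(\<Sum>t<T. \<alpha> t * (a t * gl t + (1 - a t) * gf t)) \<ge>
       (\<Sum>t<T. - (e / 2) - P / (e * lam) * (\<alpha> t - \<alpha> (Suc t))
          - \<alpha> t * (inverse (mu e t) * a t - 1) * gf t)"
      by (intro sum_mono) auto
    moreover have "(\<Sum>t<T. - (e / 2) - P / (e * lam) * (\<alpha> t - \<alpha> (Suc t))
          - \<alpha> t * (inverse (mu e t) * a t - 1) * gf t)
        = - (e / 2) * real T - P / (e * lam) * (\<alpha> 0 - \<alpha> T)
          - (\<Sum>t<T. \<alpha> t * (inverse (mu e t) * a t - 1) * gf t)"
    proof -
      have "(\<Sum>t<T. P / (e * lam) * (\<alpha> t - \<alpha> (Suc t))) = P / (e * lam) * (\<alpha> 0 - \<alpha> T)"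
        unfolding sum_distrib_left[symmetric] sum_lessThan_telescope' ..
      then show ?thesis
        unfolding sum_subtractf by simp
    qed
    moreover have "P / (e * lam) * (\<alpha> 0 - \<alpha> T) \<le> P / (e * lam) * 1"
      using \<alpha>_bounds[of 0] \<alpha>_bounds[of T] \<open>P > 0\<close> e lam by (intro mult_left_mono) auto
    moreover have "(\<Sum>t<T. \<alpha> t * (inverse (mu e t) * a t - 1) * gf t) \<le> R2 T"
      by (simp add: R2)
    ultimately show ?thesis
      by linarith
  qed

  \<comment> \<open>The nonnegative \<open>g0\<close> terms are dropped. Counting by paid stages
    instead of by absorption times turns the weighted sum into T partial sums, each at least
    -\<open>R1\<close>.\<close>
  have sharp: "(\<Sum>t<T. real (T - 1 - t) * (\<alpha> t * (a t * gs t + (1 - a t) * g0 t))) \<ge> - (5 / 2 * e) * real T"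
  proof -
    have "(\<Sum>t<T. real (T - 1 - t) * (\<alpha> t * (a t * gs t + (1 - a t) * g0 t)))
        \<ge> (\<Sum>t<T. real (T - 1 - t) * (\<alpha> t * a t * gs t))"
    proof (intro sum_mono mult_left_mono)
      fix t
      have "0 \<le> \<alpha> t * ((1 - a t) * g0 t)"
        using \<alpha>_bounds(1)[of t] a_le_1[of t] g0_ge[of t] by simp
      then show "\<alpha> t * a t * gs t \<le> \<alpha> t * (a t * gs t + (1 - a t) * g0 t)"
        by (simp add: distrib_left mult.assoc)
    qed simp
    moreover have "(\<Sum>t<T. real (T - 1 - t) * (\<alpha> t * a t * gs t)) = (\<Sum>t<T. \<Sum>s<t. \<alpha> s * a s * gs s)"
      by (rule sum_weighted_eq_sum_partial_sums)
    moreover have "(\<Sum>t<T. \<Sum>s<t. \<alpha> s * a s * gs s) \<ge> (\<Sum>t<T. - (5 / 2 * e))"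
    proof (intro sum_mono)
      fix t
      have "- (\<Sum>s<t. \<alpha> s * a s * gs s) \<le> R1 t"
        by (simp add: R1)
      then show "- (5 / 2 * e) \<le> (\<Sum>s<t. \<alpha> s * a s * gs s)"
        using R1_le[of t] by linarith
    qed
    moreover have "(\<Sum>t<T. - (5 / 2 * e)) = - (5 / 2 * e) * real T"
      by simp
    ultimately show ?thesis
      by linarith
  qed

  \<comment> \<open>From T + 1 <= 2 T the factor 5/2 becomes 5; then 5 P <= (5/4) T lam e^3, and lam
    e^3 <= e / 4 since e < 1/2.\<close>
  have R2T: "R2 T \<le> real T * e * 5 / 16"
  proof -
    have "real (Suc T) powr (3 / 4) \<le> (2 * real T) powr (3 / 4)"
      using Tpos by (intro powr_mono2) auto
    also have "\<dots> = 2 powr (3 / 4) * P"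
      by (simp add: powr_mult P_def)
    also have "\<dots> \<le> 2 powr 1 * P"
      using \<open>P > 0\<close> by (intro mult_right_mono powr_mono) auto
    finally have "R2 T \<le> 5 * P"
      using R2_le[of T] by simp
    moreover have "real T * (lam * e ^ 3) \<le> real T * (1 * (e * (1 / 4)))"
    proof -
      have "e * e \<le> 1 / 2 * (1 / 2)"
        using e by (intro mult_mono) auto
      then have "e * (e * e) \<le> e * (1 / 4)"
        using e by (intro mult_left_mono) auto
      then show ?thesis
        using lam e by (intro mult_left_mono mult_mono) (auto simp: power3_eq_cube)
    qed
    ultimately show ?thesis
      using P_le by simp
  qed

  have "P / (e * lam) \<le> real T * e / 8"
  proof -
    have "P / (e * lam) \<le> real T * (lam * e ^ 3) / 4 / (e * lam)"
      using P_le e lam by (intro divide_right_mono) auto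
    also have "\<dots> = real T * e * e / 4"
      using e lam by (simp add: power3_eq_cube)
    also have "\<dots> \<le> real T * e * (1 / 2) / 4"
      using e by (intro divide_right_mono mult_left_mono) auto
    finally show ?thesis
      by simp
  qed
  moreover have "(\<Sum>t<T. \<alpha> t * (a t * gl t + (1 - a t) * gf t
              + real (T - 1 - t) * (a t * gs t + (1 - a t) * g0 t))) =
      (\<Sum>t<T. \<alpha> t * (a t * gl t + (1 - a t) * gf t)) +
      (\<Sum>t<T. real (T - 1 - t) * (\<alpha> t * (a t * gs t + (1 - a t) * g0 t)))"
    by (simp add: algebra_simps flip: sum.distrib)
  moreover have "0 \<le> real T * e"
    using e by simp
  moreover have "- (e / 2) * real T = - (real T * e) / 2" "- (5 / 2 * e) * real T = - 5 / 2 * (real T * e)"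
    "- 8 * e * real T = - 8 * (real T * e)"
    by simp_all
  ultimately show ?thesis
    using flat sharp R2T by linarith
qed

end

section \<open>The law of the play\<close>

text \<open>The projective family \<open>CI\<close> is built from \<open>C 0 n\<close> with n =
  \<open>up_to J\<close>. Once \<open>up_to {0..<n}\<close> is computed, the law of the first n
  coordinates is the iterated kernel itself.\<close>

lemma (in Ionescu_Tulcea) nn_integral_lim:
  assumes f: "f \<in> borel_measurable (PiM {0..<n} M)"
  shows "(\<integral>\<^sup>+p. f (restrict p {0..<n}) \<partial>PF.lim) = (\<integral>\<^sup>+h. f h \<partial>C 0 n (\<lambda>_. undefined))"
proof -
  have up: "up_to {0..<n} = n"
  proof (rule antisym)
    show "up_to {0..<n} \<le> n"
      by (simp add: up_to_iff_Ico)
    show "n \<le> up_to {0..<n}"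
      using up_to[of "{0..<n}"] by (cases n) auto
  qed
  have [measurable]: "(\<lambda>p. restrict p {0..<n}) \<in> PF.lim \<rightarrow>\<^sub>M PiM {0..<n} M"
    using measurable_restrict_subset[of "{0..<n}" UNIV M]
    by (simp add: measurable_cong_sets[OF PF.sets_lim refl])
  have "(\<integral>\<^sup>+p. f (restrict p {0..<n}) \<partial>PF.lim)
      = (\<integral>\<^sup>+h. f h \<partial>distr PF.lim (PiM {0..<n} M) (\<lambda>p. restrict p {0..<n}))"
    using f by (simp add: nn_integral_distr)
  also have "\<dots> = (\<integral>\<^sup>+h. f h \<partial>distr (C 0 n (\<lambda>_. undefined)) (PiM {0..<n} M) (\<lambda>h. restrict h {0..<n}))"
    by (simp add: distr_lim CI_def up)
  also have "\<dots> = (\<integral>\<^sup>+h. f (restrict h {0..<n}) \<partial>C 0 n (\<lambda>_. undefined))"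
    using f measurable_restrict_subset[of "{0..<n}" "{0..<n}" M]
    by (subst nn_integral_distr) (auto simp: measurable_cong_sets[OF sets_C refl])
  also have "\<dots> = (\<integral>\<^sup>+h. f h \<partial>C 0 n (\<lambda>_. undefined))"
    by (intro nn_integral_cong) (auto simp: space_C space_PiM)
  finally show ?thesis .
qed

text \<open>The tower property: \<open>C 0 (Suc n)\<close> is \<open>C 0 n\<close> followed by one
  kernel, and \<open>nn_integral_lim\<close> translates both ends back to the infinite play.\<close>

lemma (in Ionescu_Tulcea) nn_integral_lim_Suc:
  assumes f: "f \<in> borel_measurable (PiM {0..<Suc n} M)"
  shows "(\<integral>\<^sup>+p. f (restrict p {0..<Suc n}) \<partial>PF.lim)
    = (\<integral>\<^sup>+p. (\<integral>\<^sup>+y. f ((restrict p {0..<n})(n := y)) \<partial>P n (restrict p {0..<n})) \<partial>PF.lim)"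
proof -
  have eP: "eP n \<in> PiM {0..<n} M \<rightarrow>\<^sub>M subprob_algebra (PiM {0..<Suc n} M)"
    by (rule measurable_eP)
  have C: "sets (C 0 n (\<lambda>_. undefined)) = sets (PiM {0..<n} M)"
    by (subst sets_C) auto
  have "(\<integral>\<^sup>+p. f (restrict p {0..<Suc n}) \<partial>PF.lim) = (\<integral>\<^sup>+h. f h \<partial>C 0 (Suc n) (\<lambda>_. undefined))"
    by (rule nn_integral_lim[OF f])
  also have "\<dots> = (\<integral>\<^sup>+h. (\<integral>\<^sup>+y. f y \<partial>eP n h) \<partial>C 0 n (\<lambda>_. undefined))"
    using eP by (simp add: nn_integral_bind[OF f] measurable_cong_sets[OF C refl])
  also have "\<dots> = (\<integral>\<^sup>+p. (\<integral>\<^sup>+y. f y \<partial>eP n (restrict p {0..<n})) \<partial>PF.lim)"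
    using nn_integral_measurable_subprob_algebra[OF f] eP
    by (intro nn_integral_lim[symmetric] measurable_compose[OF eP])
  also have "\<dots> = (\<integral>\<^sup>+p. (\<integral>\<^sup>+y. f ((restrict p {0..<n})(n := y)) \<partial>P n (restrict p {0..<n})) \<partial>PF.lim)"
    using f by (intro nn_integral_cong nn_integral_eP) (auto simp: PF.space_lim space_PiM)
  finally show ?thesis .
qed

section \<open>Histories, kernels and the law of a play\<close>

lemma measurable_stage_space[measurable]:
  "fst \<in> stage_space \<rightarrow>\<^sub>M count_space UNIV" "snd \<in> stage_space \<rightarrow>\<^sub>M borel \<Otimes>\<^sub>M borel"
  by (simp_all add: stage_space_def)

lemma space_stage_space[simp]: "space stage_space = UNIV"
  by (simp add: stage_space_def space_pair_measure)

lemma space_history_space: "space (history_space n) = extensional {0..<n}"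
  by (simp add: space_PiM space_pair_measure PiE_UNIV_domain PiE_def)

lemma measurable_actions:
  assumes "n \<le> m"
  shows "actions n \<in> PiM {0..<m} (\<lambda>_. stage_space) \<rightarrow>\<^sub>M history_space n"
    and "actions n \<in> PiM UNIV (\<lambda>_. stage_space) \<rightarrow>\<^sub>M history_space n"
  unfolding actions_def[abs_def] using assms
  by (auto intro!: measurable_restrict measurable_compose[OF _ measurable_stage_space(2)])

lemma actions_Suc: "actions (Suc n) p = (actions n p)(n := snd (p n))"
  by (auto simp: actions_def)

lemma actions_in_space: "actions n p \<in> space (history_space n)"
  by (simp add: space_history_space actions_def)

lemma restrict_actions: "m \<le> n \<Longrightarrow> restrict (actions n p) {0..<m} = actions m p"
  by (auto simp: actions_def)

lemma actions_restrict: "m \<le> n \<Longrightarrow> actions m (restrict p {0..<n}) = actions m p"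
  by (auto simp: actions_def)

lemma next_state_restrict: "next_state G n (restrict p {0..<n}) = next_state G n p"
  by (cases n) (auto simp: next_state_def)

lemma pmf_next_state_Suc:
  "pmf (next_state G (Suc n) p) w = indicator {nonabs G} (fst (p n)) * pmf (trans G (fst (snd (p n))) (snd (snd (p n)))) w
     + (if w = nonabs G then 0 else indicator {w} (fst (p n)))"
  by (auto simp: next_state_def split: prod.splits split_indicator)

locale absorbing_play =
  fixes G :: "('w::finite, 'i::topological_space, 'j::topological_space) absorbing_game"
    and \<sigma> :: "('i, 'j, 'i) strategy" and \<tau> :: "('i, 'j, 'j) strategy"
  assumes trans_measurable: "\<And>w. (\<lambda>(i, j). pmf (trans G i j) w) \<in> borel_measurable (borel \<Otimes>\<^sub>M borel)"
    and pay_measurable: "(\<lambda>(i, j). pay G i j) \<in> borel_measurable (borel \<Otimes>\<^sub>M borel)"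
    and \<sigma>: "\<sigma> \<in> behavior_strategies" and \<tau>: "\<tau> \<in> behavior_strategies"
begin

lemma trans_measurable'[measurable]:
  "(\<lambda>y. pmf (trans G (fst y) (snd y)) w) \<in> borel_measurable (borel \<Otimes>\<^sub>M borel)"
  using trans_measurable[of w] by (simp add: case_prod_unfold)

lemma pay_measurable'[measurable]:
  "(\<lambda>y. pay G (fst y) (snd y)) \<in> borel_measurable (borel \<Otimes>\<^sub>M borel)"
  using pay_measurable by (simp add: case_prod_unfold)

lemma strategy_measurable:
  "\<sigma> n \<in> history_space n \<rightarrow>\<^sub>M prob_algebra borel" "\<tau> n \<in> history_space n \<rightarrow>\<^sub>M prob_algebra borel"
  using \<sigma> \<tau> by (auto simp: behavior_strategies_def)

lemma strategy_prob:
  assumes "h \<in> space (history_space n)"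
  shows "prob_space (\<sigma> n h)" "prob_space (\<tau> n h)" "sets (\<sigma> n h) = sets borel" "sets (\<tau> n h) = sets borel"
  using measurable_space[OF strategy_measurable(1) assms] measurable_space[OF strategy_measurable(2) assms]
  by (auto simp: space_prob_algebra)

text \<open>Since \<open>'w\<close> is finite, the probability of a set is a finite sum of point
  masses, each an explicit function of the last stage.\<close>

lemma next_state_measurable:
  "(\<lambda>p. measure_pmf (next_state G n p)) \<in> PiM {0..<n} (\<lambda>_. stage_space) \<rightarrow>\<^sub>M prob_algebra (count_space UNIV)"
proof (rule measurable_prob_algebraI)
  show "prob_space (measure_pmf (next_state G n p))" for p
    by (rule prob_space_measure_pmf)
  have pmf: "(\<lambda>p. pmf (next_state G n p) w) \<in> borel_measurable (PiM {0..<n} (\<lambda>_. stage_space))" for w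
  proof (cases n)
    case 0
    then show ?thesis
      by (simp add: next_state_def)
  next
    case (Suc m)
    have [measurable]: "(\<lambda>p. p m) \<in> PiM {0..<n} (\<lambda>_. stage_space) \<rightarrow>\<^sub>M stage_space"
      using Suc by simp
    have "(\<lambda>y. indicator {nonabs G} (fst y) * pmf (trans G (fst (snd y)) (snd (snd y))) w
         + (if w = nonabs G then 0 else indicator {w} (fst y)) :: real) \<in> borel_measurable stage_space"
      by measurable
    from measurable_compose[OF \<open>(\<lambda>p. p m) \<in> _\<close> this] show ?thesis
      unfolding Suc pmf_next_state_Suc[abs_def] by simp
  qed
  show "(\<lambda>p. measure_pmf (next_state G n p)) \<in> PiM {0..<n} (\<lambda>_. stage_space) \<rightarrow>\<^sub>M subprob_algebra (count_space UNIV)"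
  proof (rule measurable_subprob_algebra)
    fix A :: "'w set"
    have "(\<lambda>p. emeasure (measure_pmf (next_state G n p)) A) = (\<lambda>p. \<Sum>w\<in>A. ennreal (pmf (next_state G n p) w))"
      by (simp add: measure_pmf.emeasure_eq_measure measure_measure_pmf_finite)
    then show "(\<lambda>p. emeasure (measure_pmf (next_state G n p)) A) \<in> borel_measurable (PiM {0..<n} (\<lambda>_. stage_space))"
      using pmf by simp
  qed (auto simp: measure_pmf.subprob_space_axioms)
qed

lemma stage_law_measurable:
  "stage_law G \<sigma> \<tau> n \<in> PiM {0..<n} (\<lambda>_. stage_space) \<rightarrow>\<^sub>M prob_algebra stage_space"
  unfolding stage_law_def[abs_def] stage_space_def[symmetric]
  using next_state_measurable[of n] measurable_compose[OF measurable_actions(1)[of n n] strategy_measurable(1)]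
    measurable_compose[OF measurable_actions(1)[of n n] strategy_measurable(2)]
  by (subst (2) stage_space_def) (intro measurable_pair_prob, auto)

sublocale Ionescu_Tulcea "stage_law G \<sigma> \<tau>" "\<lambda>_. stage_space"
proof (rule Ionescu_Tulcea.intro)
  show "stage_law G \<sigma> \<tau> n \<in> PiM {0..<n} (\<lambda>_. stage_space) \<rightarrow>\<^sub>M subprob_algebra stage_space" for n
    using stage_law_measurable by (rule measurable_prob_algebraD)
  show "prob_space (stage_law G \<sigma> \<tau> n h)" if "h \<in> space (PiM {0..<n} (\<lambda>_. stage_space))" for n h
    using measurable_space[OF stage_law_measurable that] by (simp add: space_prob_algebra)
qed

abbreviation "\<P> \<equiv> play_measure G \<sigma> \<tau>"

lemma play_measure_eq: "\<P> = PF.lim"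
  by (simp add: play_measure_def)

lemma sets_play: "sets \<P> = sets (PiM UNIV (\<lambda>_. stage_space))"
  by (simp add: play_measure_eq)

lemma prob_space_play: "prob_space \<P>"
proof
  interpret C: prob_space "C 0 0 (\<lambda>_. undefined)"
    by (rule prob_space_C) simp
  have "emeasure PF.lim (space PF.lim) = (\<integral>\<^sup>+h. 1 \<partial>C 0 0 (\<lambda>_. undefined))"
    using nn_integral_lim[of "\<lambda>_. 1" 0] by simp
  also have "\<dots> = 1"
    using C.emeasure_space_1 by (simp del: C.simps)
  finally show "emeasure \<P> (space \<P>) = 1"
    by (simp add: play_measure_eq)
qed

lemma measurable_play_component[measurable]: "(\<lambda>p. p n) \<in> \<P> \<rightarrow>\<^sub>M stage_space"
  unfolding measurable_cong_sets[OF sets_play refl] by simp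

lemma measurable_play_actions[measurable]: "actions n \<in> \<P> \<rightarrow>\<^sub>M history_space n"
  unfolding measurable_cong_sets[OF sets_play refl] by (rule measurable_actions(2)[of n n]) simp

text \<open>Conditionally on the past, the state and the two actions of a stage are independent, so
  the state integral splits off. Player I's action is integrated first, leaving a function of the
  history and of Player II's action.\<close>

lemma nn_integral_stage:
  assumes f: "(\<lambda>(h, y). f h (fst y) (snd y)) \<in> borel_measurable (history_space n \<Otimes>\<^sub>M (borel \<Otimes>\<^sub>M borel))"
  shows "(\<integral>\<^sup>+p. \<psi> (fst (p n)) * f (actions n p) (fst (snd (p n))) (snd (snd (p n))) \<partial>\<P>)
    = (\<integral>\<^sup>+p. (\<integral>\<^sup>+w. \<psi> w \<partial>next_state G n p) *
        (\<integral>\<^sup>+j. (\<integral>\<^sup>+i. f (actions n p) i j \<partial>\<sigma> n (actions n p)) \<partial>\<tau> n (actions n p)) \<partial>\<P>)"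
proof -
  define F where "F p = \<psi> (fst (p n)) * f (actions n p) (fst (snd (p n))) (snd (snd (p n)))"
    for p :: "nat \<Rightarrow> 'w \<times> 'i \<times> 'j"
  have [measurable]: "(\<lambda>p. p n) \<in> PiM {0..<Suc n} (\<lambda>_. stage_space) \<rightarrow>\<^sub>M stage_space"
    by simp
  have [measurable]: "actions n \<in> PiM {0..<Suc n} (\<lambda>_. stage_space) \<rightarrow>\<^sub>M history_space n"
    by (rule measurable_actions) simp
  have "(\<lambda>p. (actions n p, snd (p n))) \<in> PiM {0..<Suc n} (\<lambda>_. stage_space) \<rightarrow>\<^sub>M history_space n \<Otimes>\<^sub>M (borel \<Otimes>\<^sub>M borel)"
    by measurable
  from measurable_compose[OF this f]
  have F: "F \<in> borel_measurable (PiM {0..<Suc n} (\<lambda>_. stage_space))"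
    unfolding F_def by (intro borel_measurable_times_ennreal) (simp_all, measurable)
  have "(\<integral>\<^sup>+p. F p \<partial>\<P>) = (\<integral>\<^sup>+p. F (restrict p {0..<Suc n}) \<partial>\<P>)"
    by (simp add: F_def actions_restrict)
  also have "\<dots> = (\<integral>\<^sup>+p. (\<integral>\<^sup>+y. F ((restrict p {0..<n})(n := y)) \<partial>stage_law G \<sigma> \<tau> n (restrict p {0..<n})) \<partial>\<P>)"
    unfolding play_measure_eq by (rule nn_integral_lim_Suc[OF F])
  also have "\<dots> = (\<integral>\<^sup>+p. (\<integral>\<^sup>+w. \<psi> w \<partial>next_state G n p) *
        (\<integral>\<^sup>+j. (\<integral>\<^sup>+i. f (actions n p) i j \<partial>\<sigma> n (actions n p)) \<partial>\<tau> n (actions n p)) \<partial>\<P>)"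
  proof (rule nn_integral_cong)
    fix p :: "nat \<Rightarrow> 'w \<times> 'i \<times> 'j"
    let ?h = "actions n p"
    let ?K = "\<sigma> n ?h \<Otimes>\<^sub>M \<tau> n ?h"
    note prob = strategy_prob[OF actions_in_space[of n p]]
    interpret S: prob_space "\<sigma> n ?h" by (rule prob)
    interpret T: prob_space "\<tau> n ?h" by (rule prob)
    interpret ST: pair_prob_space "\<sigma> n ?h" "\<tau> n ?h" ..
    have sK: "sets ?K = sets (borel \<Otimes>\<^sub>M borel)"
      by (intro sets_pair_measure_cong prob)
    have "(\<lambda>y. (?h, y)) \<in> borel \<Otimes>\<^sub>M borel \<rightarrow>\<^sub>M history_space n \<Otimes>\<^sub>M (borel \<Otimes>\<^sub>M borel)"
      by (intro measurable_Pair measurable_const actions_in_space) simp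
    from measurable_compose[OF this f]
    have fm: "(\<lambda>y. f ?h (fst y) (snd y)) \<in> borel_measurable ?K"
      by (simp add: measurable_cong_sets[OF sK refl])
    have fm2: "(\<lambda>(i, j). f ?h i j) \<in> borel_measurable ?K"
      using fm by (simp add: case_prod_unfold)
    have upd: "actions n ((restrict p {0..<n})(n := y)) = ?h" for y
      by (auto simp: actions_def)
    have "(\<integral>\<^sup>+y. F ((restrict p {0..<n})(n := y)) \<partial>stage_law G \<sigma> \<tau> n (restrict p {0..<n}))
       = (\<integral>\<^sup>+y. \<psi> (fst y) * f ?h (fst (snd y)) (snd (snd y)) \<partial>(measure_pmf (next_state G n p) \<Otimes>\<^sub>M ?K))"
      by (simp only: F_def upd stage_law_def actions_restrict next_state_restrict order_refl fun_upd_same)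
    also have "\<dots> = (\<integral>\<^sup>+w. (\<integral>\<^sup>+y. \<psi> w * f ?h (fst y) (snd y) \<partial>?K) \<partial>next_state G n p)"
      using fm by (subst ST.nn_integral_fst[symmetric]) auto
    also have "\<dots> = (\<integral>\<^sup>+w. \<psi> w \<partial>next_state G n p) * (\<integral>\<^sup>+y. f ?h (fst y) (snd y) \<partial>?K)"
      using fm by (simp add: nn_integral_cmult nn_integral_multc)
    also have "(\<integral>\<^sup>+y. f ?h (fst y) (snd y) \<partial>?K) = (\<integral>\<^sup>+j. (\<integral>\<^sup>+i. f ?h i j \<partial>\<sigma> n ?h) \<partial>\<tau> n ?h)"
      using ST.nn_integral_snd[OF fm2] by (simp add: case_prod_unfold)
    finally show "(\<integral>\<^sup>+y. F ((restrict p {0..<n})(n := y)) \<partial>stage_law G \<sigma> \<tau> n (restrict p {0..<n})) =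
      (\<integral>\<^sup>+w. \<psi> w \<partial>next_state G n p) * (\<integral>\<^sup>+j. (\<integral>\<^sup>+i. f ?h i j \<partial>\<sigma> n ?h) \<partial>\<tau> n ?h)" .
  qed
  finally show ?thesis
    by (simp add: F_def)
qed

end

section \<open>Change of measure to non-absorbed plays\<close>

context absorbing_play
begin

lemma kernel_measurable:
  assumes f: "(\<lambda>(h, y). f h (fst y) (snd y)) \<in> borel_measurable (history_space n \<Otimes>\<^sub>M (borel \<Otimes>\<^sub>M borel))"
  shows "(\<lambda>(h, j). \<integral>\<^sup>+i. f h i j \<partial>\<sigma> n h) \<in> borel_measurable (history_space n \<Otimes>\<^sub>M borel)"
    and "(\<lambda>h. \<integral>\<^sup>+j. (\<integral>\<^sup>+i. f h i j \<partial>\<sigma> n h) \<partial>\<tau> n h) \<in> borel_measurable (history_space n)"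
proof -
  have "(\<lambda>z. (fst (fst z), snd z, snd (fst z))) \<in>
      (history_space n \<Otimes>\<^sub>M borel) \<Otimes>\<^sub>M borel \<rightarrow>\<^sub>M history_space n \<Otimes>\<^sub>M (borel \<Otimes>\<^sub>M borel)"
    by measurable
  from measurable_compose[OF this f]
  have "(\<lambda>(z, i). f (fst z) i (snd z)) \<in> borel_measurable ((history_space n \<Otimes>\<^sub>M borel) \<Otimes>\<^sub>M borel)"
    by (simp add: case_prod_unfold)
  moreover have "(\<lambda>z. \<sigma> n (fst z)) \<in> history_space n \<Otimes>\<^sub>M borel \<rightarrow>\<^sub>M subprob_algebra borel"
    by (rule measurable_compose[OF measurable_fst measurable_prob_algebraD[OF strategy_measurable(1)]])
  ultimately show *: "(\<lambda>(h, j). \<integral>\<^sup>+i. f h i j \<partial>\<sigma> n h) \<in> borel_measurable (history_space n \<Otimes>\<^sub>M borel)"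
    unfolding case_prod_unfold by (rule nn_integral_measurable_subprob_algebra2[unfolded case_prod_unfold])
  show "(\<lambda>h. \<integral>\<^sup>+j. (\<integral>\<^sup>+i. f h i j \<partial>\<sigma> n h) \<partial>\<tau> n h) \<in> borel_measurable (history_space n)"
    by (rule nn_integral_measurable_subprob_algebra2[OF * measurable_prob_algebraD[OF strategy_measurable(2)]])
qed

lemma measurable_history_upd:
  assumes "\<phi> \<in> borel_measurable (history_space (Suc n))"
  shows "(\<lambda>(h, y). \<phi> (h(n := y))) \<in> borel_measurable (history_space n \<Otimes>\<^sub>M (borel \<Otimes>\<^sub>M borel))"
proof -
  have "(\<lambda>(h, y). h(n := y)) \<in> history_space n \<Otimes>\<^sub>M (borel \<Otimes>\<^sub>M borel) \<rightarrow>\<^sub>M history_space (Suc n)"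
    using measurable_add_dim[of n "{0..<n}" "\<lambda>_. borel \<Otimes>\<^sub>M borel"] by (simp add: atLeast0_lessThan_Suc)
  from measurable_compose[OF this assms] show ?thesis
    by (simp add: case_prod_unfold)
qed

abbreviation stay :: "'i \<Rightarrow> 'j \<Rightarrow> ennreal" where
  "stay i j \<equiv> ennreal (pmf (trans G i j) (nonabs G))"

lemma measurable_prod_stay:
  "(\<lambda>h. \<Prod>s<n. stay (fst (h s)) (snd (h s))) \<in> borel_measurable (history_space n)"
proof (rule borel_measurable_prod_ennreal)
  fix s assume "s \<in> {..<n}"
  then have [measurable]: "(\<lambda>h. h s) \<in> history_space n \<rightarrow>\<^sub>M borel \<Otimes>\<^sub>M borel"
    by simp
  show "(\<lambda>h. stay (fst (h s)) (snd (h s))) \<in> borel_measurable (history_space n)"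
    by measurable
qed

lemma nn_integral_indicator_next_state:
  "(\<integral>\<^sup>+w. indicator {v} w \<partial>next_state G n p) = ennreal (pmf (next_state G n p) v)"
  by (simp add: emeasure_pmf_single)

text \<open>Strategies see actions only, so the actions keep their law after absorption, and
  non-absorption acts as a killing with the probabilities \<open>stay\<close> along the realised
  actions. The test function is arbitrary because the induction step applies the hypothesis to the
  integral of the last stage.\<close>

lemma nn_integral_survival:
  assumes "\<phi> \<in> borel_measurable (history_space n)"
  shows "(\<integral>\<^sup>+p. ennreal (pmf (next_state G n p) (nonabs G)) * \<phi> (actions n p) \<partial>\<P>)
    = (\<integral>\<^sup>+p. (\<Prod>s<n. stay (fst (actions n p s)) (snd (actions n p s))) * \<phi> (actions n p) \<partial>\<P>)"
  using assms
proof (induction n arbitrary: \<phi>)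
  case 0
  then show ?case
    by (simp add: next_state_def)
next
  case (Suc n)
  define f where "f h i j = stay i j * \<phi> (h(n := (i, j)))" for h i j
  define S where "S h = (\<Prod>s<n. stay (fst (h s)) (snd (h s)))" for h :: "nat \<Rightarrow> 'i \<times> 'j"
  note [measurable] = measurable_history_upd[OF Suc.prems]
  have f: "(\<lambda>(h, y). f h (fst y) (snd y)) \<in> borel_measurable (history_space n \<Otimes>\<^sub>M (borel \<Otimes>\<^sub>M borel))"
    unfolding f_def by (simp add: case_prod_unfold)
  have [measurable]: "S \<in> borel_measurable (history_space n)"
    unfolding S_def by (rule measurable_prod_stay)
  have Sf: "(\<lambda>(h, y). S h * f h (fst y) (snd y)) \<in> borel_measurable (history_space n \<Otimes>\<^sub>M (borel \<Otimes>\<^sub>M borel))"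
    using f by (simp add: case_prod_unfold)
  have "(\<integral>\<^sup>+p. ennreal (pmf (next_state G (Suc n) p) (nonabs G)) * \<phi> (actions (Suc n) p) \<partial>\<P>)
      = (\<integral>\<^sup>+p. indicator {nonabs G} (fst (p n)) * f (actions n p) (fst (snd (p n))) (snd (snd (p n))) \<partial>\<P>)"
    by (intro nn_integral_cong) (auto simp: pmf_next_state_Suc actions_Suc f_def split: split_indicator)
  also have "\<dots> = (\<integral>\<^sup>+p. ennreal (pmf (next_state G n p) (nonabs G)) *
      (\<integral>\<^sup>+j. (\<integral>\<^sup>+i. f (actions n p) i j \<partial>\<sigma> n (actions n p)) \<partial>\<tau> n (actions n p)) \<partial>\<P>)"
    unfolding nn_integral_stage[OF f] nn_integral_indicator_next_state ..
  also have "\<dots> = (\<integral>\<^sup>+p. S (actions n p) *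
      (\<integral>\<^sup>+j. (\<integral>\<^sup>+i. f (actions n p) i j \<partial>\<sigma> n (actions n p)) \<partial>\<tau> n (actions n p)) \<partial>\<P>)"
    unfolding S_def by (rule Suc.IH[OF kernel_measurable(2)[OF f]])
  \<comment> \<open>The integral of the last stage is undone: \<open>nn_integral_stage\<close> is
    read backwards, now with the constant 1 in place of the indicator of the state.\<close>
  also have "\<dots> = (\<integral>\<^sup>+p. 1 * (S (actions n p) * f (actions n p) (fst (snd (p n))) (snd (snd (p n)))) \<partial>\<P>)"
  proof (subst nn_integral_stage[OF Sf], rule nn_integral_cong)
    fix p :: "nat \<Rightarrow> 'w \<times> 'i \<times> 'j"
    let ?h = "actions n p"
    note prob = strategy_prob[OF actions_in_space[of n p]]
    have "(\<lambda>j. (?h, j)) \<in> borel \<rightarrow>\<^sub>M history_space n \<Otimes>\<^sub>M borel"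
      by (intro measurable_Pair measurable_const actions_in_space) simp
    from measurable_compose[OF this kernel_measurable(1)[OF f]]
    have m1: "(\<lambda>j. \<integral>\<^sup>+i. f ?h i j \<partial>\<sigma> n ?h) \<in> borel_measurable (\<tau> n ?h)"
      by (simp add: measurable_cong_sets[OF prob(4) refl])
    have m2: "(\<lambda>i. f ?h i j) \<in> borel_measurable (\<sigma> n ?h)" for j
    proof -
      have "(\<lambda>i. (?h, i, j)) \<in> borel \<rightarrow>\<^sub>M history_space n \<Otimes>\<^sub>M (borel \<Otimes>\<^sub>M borel)"
        by (intro measurable_Pair measurable_const actions_in_space) simp_all
      from measurable_compose[OF this f] show ?thesis
        by (simp add: measurable_cong_sets[OF prob(3) refl])
    qed
    show "S ?h * (\<integral>\<^sup>+j. (\<integral>\<^sup>+i. f ?h i j \<partial>\<sigma> n ?h) \<partial>\<tau> n ?h) =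
       (\<integral>\<^sup>+w. 1 \<partial>next_state G n p) * (\<integral>\<^sup>+j. (\<integral>\<^sup>+i. S ?h * f ?h i j \<partial>\<sigma> n ?h) \<partial>\<tau> n ?h)"
      by (simp add: nn_integral_cmult[OF m2] nn_integral_cmult[OF m1] measure_pmf.emeasure_space_1[simplified])
  qed
  also have "\<dots> = (\<integral>\<^sup>+p. (\<Prod>s<Suc n. stay (fst (actions (Suc n) p s)) (snd (actions (Suc n) p s)))
      * \<phi> (actions (Suc n) p) \<partial>\<P>)"
    by (intro nn_integral_cong) (auto simp: S_def f_def actions_Suc mult_ac intro!: prod.cong)
  finally show ?case .
qed

text \<open>An expectation restricted to, but not conditioned on, non-absorption before the stage;
  this keeps it linear in the integrand.\<close>

definition live :: "nat \<Rightarrow> ('i \<Rightarrow> 'j \<Rightarrow> ennreal) \<Rightarrow> ennreal" where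
  "live n c = (\<integral>\<^sup>+p. indicator {nonabs G} (fst (p n)) * c (fst (snd (p n))) (snd (snd (p n))) \<partial>\<P>)"

lemma measurable_ignore_history:
  assumes c: "(\<lambda>y. c (fst y) (snd y)) \<in> borel_measurable (borel \<Otimes>\<^sub>M borel)"
  shows "(\<lambda>(h, y). c (fst y) (snd y)) \<in> borel_measurable (history_space n \<Otimes>\<^sub>M (borel \<Otimes>\<^sub>M borel))"
  using measurable_compose[OF measurable_snd c, of "history_space n"] by (simp add: case_prod_unfold)

lemma live_eq:
  assumes c: "(\<lambda>y. c (fst y) (snd y)) \<in> borel_measurable (borel \<Otimes>\<^sub>M borel)"
  shows "live n c = (\<integral>\<^sup>+p. (\<Prod>s<n. stay (fst (actions n p s)) (snd (actions n p s))) *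
      (\<integral>\<^sup>+j. (\<integral>\<^sup>+i. c i j \<partial>\<sigma> n (actions n p)) \<partial>\<tau> n (actions n p)) \<partial>\<P>)"
proof -
  note c' = measurable_ignore_history[OF c, of n]
  have "live n c = (\<integral>\<^sup>+p. ennreal (pmf (next_state G n p) (nonabs G)) *
      (\<integral>\<^sup>+j. (\<integral>\<^sup>+i. c i j \<partial>\<sigma> n (actions n p)) \<partial>\<tau> n (actions n p)) \<partial>\<P>)"
    unfolding live_def nn_integral_stage[OF c'] nn_integral_indicator_next_state ..
  then show ?thesis
    by (simp only: nn_integral_survival[OF kernel_measurable(2)[OF c']])
qed

section \<open>Survival along the actions of Player II and the likelihood ratio\<close>

definition stay_prob :: "nat \<Rightarrow> (nat \<Rightarrow> 'i \<times> 'j) \<Rightarrow> 'j \<Rightarrow> ennreal" where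
  "stay_prob n h j = (\<integral>\<^sup>+i. stay i j \<partial>\<sigma> n h)"

text \<open>For \<open>sigma_star\<close> this is \<open>alpha_seq\<close>. Restricting
  \<open>h\<close> matters because strategies receive extensional histories of the exact
  length.\<close>

definition survival :: "nat \<Rightarrow> (nat \<Rightarrow> 'i \<times> 'j) \<Rightarrow> ennreal" where
  "survival n h = (\<Prod>s<n. stay_prob s (restrict h {0..<s}) (snd (h s)))"

text \<open>
  The likelihood ratio turns the law of the actions into the one that is conditioned on
  non-absorption at every stage; where \<open>stay_prob\<close> vanishes it is left unchanged, so that it always
  has conditional expectation 1.
\<close>

definition lik_factor :: "nat \<Rightarrow> (nat \<Rightarrow> 'i \<times> 'j) \<Rightarrow> 'i \<Rightarrow> 'j \<Rightarrow> ennreal" where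
  "lik_factor n h i j = (if stay_prob n h j = 0 then 1 else stay i j / stay_prob n h j)"

definition likelihood :: "nat \<Rightarrow> (nat \<Rightarrow> 'i \<times> 'j) \<Rightarrow> ennreal" where
  "likelihood n h = (\<Prod>s<n. lik_factor s (restrict h {0..<s}) (fst (h s)) (snd (h s)))"

lemma stay_prob_le_1: "h \<in> space (history_space n) \<Longrightarrow> stay_prob n h j \<le> 1"
proof -
  assume "h \<in> space (history_space n)"
  then interpret prob_space "\<sigma> n h"
    by (rule strategy_prob)
  have "stay_prob n h j \<le> (\<integral>\<^sup>+i. 1 \<partial>\<sigma> n h)"
    unfolding stay_prob_def by (intro nn_integral_mono) (simp add: pmf_le_1)
  then show "stay_prob n h j \<le> 1"
    by (simp add: emeasure_space_1)
qed

lemma stay_measurable: "(\<lambda>y. stay (fst y) (snd y)) \<in> borel_measurable (borel \<Otimes>\<^sub>M borel)"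
  by measurable

lemma measurable_stay_prob:
  "(\<lambda>(h, j). stay_prob n h j) \<in> borel_measurable (history_space n \<Otimes>\<^sub>M borel)"
  unfolding stay_prob_def by (rule kernel_measurable(1)[OF measurable_ignore_history[OF stay_measurable]])

lemma measurable_lik_factor:
  "(\<lambda>(h, y). lik_factor n h (fst y) (snd y)) \<in> borel_measurable (history_space n \<Otimes>\<^sub>M (borel \<Otimes>\<^sub>M borel))"
proof -
  have "(\<lambda>z. (fst z, snd (snd z))) \<in> history_space n \<Otimes>\<^sub>M (borel \<Otimes>\<^sub>M borel) \<rightarrow>\<^sub>M history_space n \<Otimes>\<^sub>M borel"
    by measurable
  from measurable_compose[OF this measurable_stay_prob]
  have [measurable]: "(\<lambda>z. stay_prob n (fst z) (snd (snd z))) \<in> borel_measurable (history_space n \<Otimes>\<^sub>M (borel \<Otimes>\<^sub>M borel))"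
    by (simp add: case_prod_unfold)
  show ?thesis
    unfolding lik_factor_def case_prod_unfold by measurable
qed

lemma measurable_history_restrict:
  assumes s: "s < n" and f: "(\<lambda>(h, y). f h y) \<in> borel_measurable (history_space s \<Otimes>\<^sub>M (borel \<Otimes>\<^sub>M borel))"
  shows "(\<lambda>h. f (restrict h {0..<s}) (h s)) \<in> borel_measurable (history_space n)"
proof -
  have "(\<lambda>h. (restrict h {0..<s}, h s)) \<in> history_space n \<rightarrow>\<^sub>M history_space s \<Otimes>\<^sub>M (borel \<Otimes>\<^sub>M borel)"
    using s by (intro measurable_Pair measurable_restrict_subset) auto
  from measurable_compose[OF this f] show ?thesis
    by simp
qed

lemma measurable_likelihood[measurable]: "likelihood n \<in> borel_measurable (history_space n)"
  unfolding likelihood_def[abs_def]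
  by (intro borel_measurable_prod_ennreal measurable_history_restrict[OF _ measurable_lik_factor]) simp

lemma measurable_history_snd:
  assumes "(\<lambda>(h, j). f h j) \<in> borel_measurable (history_space s \<Otimes>\<^sub>M borel)"
  shows "(\<lambda>(h, y). f h (snd y)) \<in> borel_measurable (history_space s \<Otimes>\<^sub>M (borel \<Otimes>\<^sub>M borel))"
proof -
  have "(\<lambda>z. (fst z, snd (snd z))) \<in> history_space s \<Otimes>\<^sub>M (borel \<Otimes>\<^sub>M borel) \<rightarrow>\<^sub>M history_space s \<Otimes>\<^sub>M borel"
    by measurable
  from measurable_compose[OF this assms] show ?thesis
    by (simp add: case_prod_unfold)
qed

lemma measurable_survival: "survival n \<in> borel_measurable (history_space n)"
  unfolding survival_def[abs_def]
  by (intro borel_measurable_prod_ennreal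
      measurable_history_restrict[OF _ measurable_history_snd[OF measurable_stay_prob]]) simp

text \<open>Factor by factor, \<open>stay_prob\<close> cancels the denominator of
  \<open>lik_factor\<close>, giving equality where it is nonzero; where it is zero the left factor
  is 0.\<close>

lemma likelihood_survival_le: "likelihood n h * survival n h \<le> (\<Prod>s<n. stay (fst (h s)) (snd (h s)))"
proof (induction n)
  case (Suc n)
  let ?h = "restrict h {0..<n}"
  let ?q = "stay_prob n ?h (snd (h n))"
  have "?q \<le> 1"
    by (rule stay_prob_le_1) (simp add: space_history_space)
  then have "?q \<noteq> top"
    by (auto simp: top_unique)
  then have "lik_factor n ?h (fst (h n)) (snd (h n)) * ?q \<le> stay (fst (h n)) (snd (h n))"
    by (simp add: lik_factor_def ennreal_divide_times ennreal_times_divide[symmetric] ennreal_divide_self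
          divide_mult_eq less_top)
  from mult_mono[OF Suc this] show ?case
    by (simp add: likelihood_def survival_def mult_ac)
qed (simp add: likelihood_def survival_def)

lemma likelihood_Suc:
  "likelihood (Suc n) (actions (Suc n) p)
    = likelihood n (actions n p) * lik_factor n (actions n p) (fst (snd (p n))) (snd (snd (p n)))"
proof -
  have "likelihood n (actions (Suc n) p) = likelihood n (actions n p)"
    unfolding likelihood_def by (intro prod.cong refl) (auto simp: restrict_actions actions_Suc)
  then show ?thesis
    by (simp add: likelihood_def restrict_actions) (simp add: actions_def)
qed

text \<open>Given the history and Player II's current action, \<open>lik_factor\<close> has mean 1
  under Player I's mixed action, also where \<open>stay_prob\<close> is 0. The reweighting of the
  stage is therefore invisible to any \<open>Y\<close> that does not look at Player I's current
  action.\<close>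

lemma nn_integral_likelihood_Suc:
  assumes Y: "(\<lambda>(h, j). Y h j) \<in> borel_measurable (history_space n \<Otimes>\<^sub>M borel)"
  shows "(\<integral>\<^sup>+p. likelihood (Suc n) (actions (Suc n) p) * Y (actions n p) (snd (snd (p n))) \<partial>\<P>)
    = (\<integral>\<^sup>+p. likelihood n (actions n p) * (\<integral>\<^sup>+j. Y (actions n p) j \<partial>\<tau> n (actions n p)) \<partial>\<P>)"
proof -
  define f where "f h i j = likelihood n h * Y h j * lik_factor n h i j" for h i j
  have f: "(\<lambda>(h, y). f h (fst y) (snd y)) \<in> borel_measurable (history_space n \<Otimes>\<^sub>M (borel \<Otimes>\<^sub>M borel))"
    unfolding f_def case_prod_unfold
    by (intro borel_measurable_times_ennreal measurable_lik_factor[unfolded case_prod_unfold]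
        measurable_history_snd[OF Y, unfolded case_prod_unfold]
        measurable_compose[OF measurable_fst measurable_likelihood])
  have "(\<integral>\<^sup>+p. likelihood (Suc n) (actions (Suc n) p) * Y (actions n p) (snd (snd (p n))) \<partial>\<P>)
      = (\<integral>\<^sup>+p. 1 * f (actions n p) (fst (snd (p n))) (snd (snd (p n))) \<partial>\<P>)"
    by (simp add: f_def likelihood_Suc mult_ac)
  also have "\<dots> = (\<integral>\<^sup>+p. (\<integral>\<^sup>+j. (\<integral>\<^sup>+i. f (actions n p) i j \<partial>\<sigma> n (actions n p)) \<partial>\<tau> n (actions n p)) \<partial>\<P>)"
    by (subst nn_integral_stage[OF f]) (simp add: measure_pmf.emeasure_space_1[simplified])
  also have "\<dots> = (\<integral>\<^sup>+p. likelihood n (actions n p) * (\<integral>\<^sup>+j. Y (actions n p) j \<partial>\<tau> n (actions n p)) \<partial>\<P>)"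
  proof (rule nn_integral_cong)
    fix p :: "nat \<Rightarrow> 'w \<times> 'i \<times> 'j"
    let ?h = "actions n p"
    note prob = strategy_prob[OF actions_in_space[of n p]]
    interpret S: prob_space "\<sigma> n ?h" by (rule prob)
    have mf: "(\<lambda>i. stay i j) \<in> borel_measurable (\<sigma> n ?h)" for j
    proof -
      have "(\<lambda>i. (i, j)) \<in> borel \<rightarrow>\<^sub>M borel \<Otimes>\<^sub>M borel"
        by simp
      from measurable_compose[OF this stay_measurable] show ?thesis
        by (simp add: measurable_cong_sets[OF prob(3) refl])
    qed
    have 1: "(\<integral>\<^sup>+i. lik_factor n ?h i j \<partial>\<sigma> n ?h) = 1" for j
    proof (cases "stay_prob n ?h j = 0")
      case True
      then show ?thesis
        by (simp add: lik_factor_def S.emeasure_space_1)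
    next
      case False
      have "stay_prob n ?h j \<noteq> top"
        using stay_prob_le_1[OF actions_in_space[of n p], of j] by (auto simp: top_unique)
      then show ?thesis
        using False mf[of j] by (simp add: lik_factor_def nn_integral_divide ennreal_divide_self
            stay_prob_def[symmetric] less_top)
    qed
    have "(\<lambda>i. lik_factor n ?h i j) \<in> borel_measurable (\<sigma> n ?h)" for j
      unfolding lik_factor_def using mf[of j] by simp
    then have "(\<integral>\<^sup>+i. f ?h i j \<partial>\<sigma> n ?h) = likelihood n ?h * Y ?h j" for j
      by (simp add: f_def nn_integral_cmult 1)
    moreover have "(\<lambda>j. Y ?h j) \<in> borel_measurable (\<tau> n ?h)"
    proof -
      have "(\<lambda>j. (?h, j)) \<in> borel \<rightarrow>\<^sub>M history_space n \<Otimes>\<^sub>M borel"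
        by (intro measurable_Pair measurable_const actions_in_space) simp
      from measurable_compose[OF this Y] show ?thesis
        by (simp add: measurable_cong_sets[OF prob(4) refl])
    qed
    ultimately show "(\<integral>\<^sup>+j. (\<integral>\<^sup>+i. f ?h i j \<partial>\<sigma> n ?h) \<partial>\<tau> n ?h)
        = likelihood n ?h * (\<integral>\<^sup>+j. Y ?h j \<partial>\<tau> n ?h)"
      by (simp add: nn_integral_cmult)
  qed
  finally show ?thesis .
qed

lemma nn_integral_likelihood: "(\<integral>\<^sup>+p. likelihood n (actions n p) \<partial>\<P>) = 1"
proof (induction n)
  case 0
  interpret prob_space \<P> by (rule prob_space_play)
  show ?case
    by (simp add: likelihood_def emeasure_space_1)
next
  case (Suc n)
  have 1: "(\<integral>\<^sup>+j. 1 \<partial>\<tau> n (actions n p)) = 1" for p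
    using prob_space.emeasure_space_1[OF strategy_prob(2)[OF actions_in_space[of n p]]] by simp
  show ?case
    using nn_integral_likelihood_Suc[of "\<lambda>_ _. 1" n] unfolding 1 using Suc by simp
qed

text \<open>
  Player II may correlate her actions with the past actions of Player I, so the survival probability
  given the actions of Player II alone is not \<open>survival\<close>; the change of measure by \<open>likelihood\<close>
  restores this.
\<close>

lemma live_sum_ge:
  assumes c: "\<And>t. (\<lambda>y. c t (fst y) (snd y)) \<in> borel_measurable (borel \<Otimes>\<^sub>M borel)"
    and path: "\<And>h. K \<le> (\<Sum>t<T. survival t h * (\<integral>\<^sup>+i. c t i (snd (h t)) \<partial>\<sigma> t (restrict h {0..<t})))"
  shows "K \<le> (\<Sum>t<T. live t (c t))"
proof -
  define m where "m t h j = (\<integral>\<^sup>+i. c t i j \<partial>\<sigma> t h)" for t h j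
  define X where "X n h = (\<Sum>t<n. survival t h * m t (restrict h {0..<t}) (snd (h t)))" for n h
  have m: "(\<lambda>(h, j). m t h j) \<in> borel_measurable (history_space t \<Otimes>\<^sub>M borel)" for t
    unfolding m_def by (rule kernel_measurable(1)[OF measurable_ignore_history[OF c]])
  have survival_restrict: "survival t (restrict h {0..<t}) = survival t h" for t h
    unfolding survival_def by (intro prod.cong refl) (auto simp: min_def)
  have survival_meas: "survival t \<in> borel_measurable (history_space n)" if "t \<le> n" for t n
  proof -
    have "(\<lambda>h. restrict h {0..<t}) \<in> history_space n \<rightarrow>\<^sub>M history_space t"
      using that by (intro measurable_restrict_subset) auto
    from measurable_compose[OF this measurable_survival] show ?thesis
      by (simp add: survival_restrict)
  qed
  have X: "X n \<in> borel_measurable (history_space n)" for n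
    unfolding X_def[abs_def]
    by (intro borel_measurable_sum borel_measurable_times_ennreal survival_meas
      measurable_history_restrict[OF _ measurable_history_snd[OF m]]) simp_all
  \<comment> \<open>The reweighted mean of the path sum grows per stage by the mean of likelihood
    times survival times stage integral, which \<open>likelihood_survival_le\<close> bounds by the
    integrand of \<open>live_eq\<close>.\<close>
  have "(\<integral>\<^sup>+p. likelihood n (actions n p) * X n (actions n p) \<partial>\<P>) \<le> (\<Sum>t<n. live t (c t))" for n
  proof (induction n)
    case (Suc n)
    \<comment> \<open>\<open>X (Suc n)\<close> seen as a function of the earlier history and Player
      II's action alone, the form that \<open>nn_integral_likelihood_Suc\<close> accepts.\<close>
    define Y where "Y h j = X n h + survival n h * m n h j" for h j
    have [measurable]: "X n \<in> borel_measurable (history_space n)" "survival n \<in> borel_measurable (history_space n)"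
      by (rule X survival_meas order_refl)+
    have Y: "(\<lambda>(h, j). Y h j) \<in> borel_measurable (history_space n \<Otimes>\<^sub>M borel)"
      using m[of n] unfolding Y_def by (simp add: case_prod_unfold)
    have XY: "X (Suc n) (actions (Suc n) p) = Y (actions n p) (snd (snd (p n)))"
      for p :: "nat \<Rightarrow> 'w \<times> 'i \<times> 'j"
    proof -
      have s: "survival t (actions (Suc n) p) = survival t (actions n p)" if "t \<le> n" for t
        using that survival_restrict[of t "actions (Suc n) p"] survival_restrict[of t "actions n p"]
        by (simp add: restrict_actions)
      have "X n (actions (Suc n) p) = X n (actions n p)"
        unfolding X_def by (intro sum.cong refl) (simp add: s restrict_actions less_imp_le, simp add: actions_def)
      then show ?thesis
        by (simp add: X_def Y_def s restrict_actions) (simp add: actions_def)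
    qed
    have "(\<integral>\<^sup>+p. likelihood (Suc n) (actions (Suc n) p) * X (Suc n) (actions (Suc n) p) \<partial>\<P>)
      = (\<integral>\<^sup>+p. likelihood n (actions n p) * (\<integral>\<^sup>+j. Y (actions n p) j \<partial>\<tau> n (actions n p)) \<partial>\<P>)"
      unfolding XY by (rule nn_integral_likelihood_Suc[OF Y])
    also have "\<dots> = (\<integral>\<^sup>+p. likelihood n (actions n p) * X n (actions n p) +
        likelihood n (actions n p) * survival n (actions n p) * (\<integral>\<^sup>+j. m n (actions n p) j \<partial>\<tau> n (actions n p)) \<partial>\<P>)"
    proof (rule nn_integral_cong)
      fix p :: "nat \<Rightarrow> 'w \<times> 'i \<times> 'j"
      let ?h = "actions n p"
      note prob = strategy_prob[OF actions_in_space[of n p]]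
      interpret T: prob_space "\<tau> n ?h" by (rule prob)
      have "(\<lambda>j. (?h, j)) \<in> borel \<rightarrow>\<^sub>M history_space n \<Otimes>\<^sub>M borel"
        by (intro measurable_Pair measurable_const actions_in_space) simp
      from measurable_compose[OF this m]
      have "(\<lambda>j. m n ?h j) \<in> borel_measurable (\<tau> n ?h)"
        by (simp add: measurable_cong_sets[OF prob(4) refl])
      then have "(\<integral>\<^sup>+j. Y ?h j \<partial>\<tau> n ?h) = X n ?h + survival n ?h * (\<integral>\<^sup>+j. m n ?h j \<partial>\<tau> n ?h)"
        by (simp add: Y_def nn_integral_add nn_integral_cmult T.emeasure_space_1)
      then show "likelihood n ?h * (\<integral>\<^sup>+j. Y ?h j \<partial>\<tau> n ?h) = likelihood n ?h * X n ?h +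
        likelihood n ?h * survival n ?h * (\<integral>\<^sup>+j. m n ?h j \<partial>\<tau> n ?h)"
        by (simp add: distrib_left mult.assoc)
    qed
    also have "\<dots> \<le> (\<integral>\<^sup>+p. likelihood n (actions n p) * X n (actions n p) +
        (\<Prod>s<n. stay (fst (actions n p s)) (snd (actions n p s))) *
          (\<integral>\<^sup>+j. m n (actions n p) j \<partial>\<tau> n (actions n p)) \<partial>\<P>)"
      by (intro nn_integral_mono add_left_mono mult_right_mono likelihood_survival_le) simp
    also have "\<dots> = (\<integral>\<^sup>+p. likelihood n (actions n p) * X n (actions n p) \<partial>\<P>) + live n (c n)"
      unfolding live_eq[OF c] m_def[symmetric]
    proof (rule nn_integral_add)
      show "(\<lambda>p. likelihood n (actions n p) * X n (actions n p)) \<in> borel_measurable \<P>"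
        by measurable
      have "(\<lambda>h. (\<Prod>s<n. stay (fst (h s)) (snd (h s))) * (\<integral>\<^sup>+j. m n h j \<partial>\<tau> n h)) \<in> borel_measurable (history_space n)"
        unfolding m_def by (intro borel_measurable_times_ennreal measurable_prod_stay
          kernel_measurable(2)[OF measurable_ignore_history[OF c]])
      from measurable_compose[OF measurable_play_actions this]
      show "(\<lambda>p. (\<Prod>s<n. stay (fst (actions n p s)) (snd (actions n p s))) *
          (\<integral>\<^sup>+j. m n (actions n p) j \<partial>\<tau> n (actions n p))) \<in> borel_measurable \<P>" .
    qed
    also have "\<dots> \<le> (\<Sum>t<Suc n. live t (c t))"
      using Suc by (simp add: add_right_mono)
    finally show ?case .
  qed (simp add: X_def)
  from this[of T] have "(\<integral>\<^sup>+p. likelihood T (actions T p) * X T (actions T p) \<partial>\<P>) \<le> (\<Sum>t<T. live t (c t))" .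
  \<comment> \<open>The bound K holds along every path and the likelihood has mean 1, so K passes to
    the reweighted mean unchanged.\<close>
  moreover have "(\<integral>\<^sup>+p. likelihood T (actions T p) * K \<partial>\<P>) \<le> (\<integral>\<^sup>+p. likelihood T (actions T p) * X T (actions T p) \<partial>\<P>)"
    using path unfolding X_def m_def by (intro nn_integral_mono mult_left_mono) auto
  moreover have "(\<integral>\<^sup>+p. likelihood T (actions T p) * K \<partial>\<P>) = K"
    using nn_integral_likelihood[of T] by (subst nn_integral_multc) auto
  ultimately show ?thesis
    by simp
qed

end

section \<open>Total payoffs\<close>

lemma Delta_iff: "x \<in> Delta \<longleftrightarrow> prob_space x \<and> sets x = sets borel"
  by (auto simp: space_prob_algebra)

section \<open>Mixtures of two mixed actions\<close>

context
  fixes a :: real and x y :: "'a::topological_space measure"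
  assumes a: "0 \<le> a" "a \<le> 1" and x: "x \<in> Delta" and y: "y \<in> Delta"
begin

text \<open>\<open>measure_of\<close> gives the intended values only for a countably additive set
  function. Identifying the mixture with a Bernoulli draw between x and y supplies this.\<close>

lemma convex_comb_eq_bind:
  "convex_comb a x y = measure_pmf (bernoulli_pmf a) \<bind> (\<lambda>b. if b then x else y)"
proof -
  let ?K = "\<lambda>b. if b then x else y"
  let ?N = "measure_pmf (bernoulli_pmf a) \<bind> ?K"
  have K: "?K \<in> measure_pmf (bernoulli_pmf a) \<rightarrow>\<^sub>M subprob_algebra borel"
    using x y by (auto simp: space_subprob_algebra Delta_iff prob_space_imp_subprob_space)
  have sx: "space x = UNIV" "sets x = sets borel" "sets y = sets borel"
    using x y sets_eq_imp_space_eq[of x borel] by (auto simp: Delta_iff)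
  have N: "space ?N = UNIV" "sets ?N = sets borel"
    using sets_bind[of "measure_pmf (bernoulli_pmf a)" ?K borel] sets_eq_imp_space_eq[of ?N borel] sx by auto
  have "ennreal a * emeasure x A + ennreal (1 - a) * emeasure y A = emeasure ?N A" if "A \<in> sets borel" for A
    using a that by (simp add: emeasure_bind[OF _ K] nn_integral_bernoulli_pmf mult.commute)
  then have "convex_comb a x y = measure_of (space ?N) (sets ?N) (emeasure ?N)"
    unfolding convex_comb_def N sx
    using sets.sigma_sets_eq[of "borel :: 'a measure"] by (intro measure_of_eq) auto
  then show ?thesis
    by (simp add: measure_of_of_measure)
qed

lemma convex_comb_in_Delta: "convex_comb a x y \<in> Delta"
proof -
  have "(\<lambda>b. if b then x else y) \<in> measure_pmf (bernoulli_pmf a) \<rightarrow>\<^sub>M prob_algebra borel"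
    using x y by auto
  moreover have "measure_pmf (bernoulli_pmf a) \<in> space (prob_algebra (measure_pmf (bernoulli_pmf a)))"
    by (simp add: space_prob_algebra prob_space_measure_pmf)
  ultimately show ?thesis
    unfolding convex_comb_eq_bind Delta_iff
    by (metis prob_space_bind' sets_bind')
qed

lemma nn_integral_convex_comb:
  assumes "f \<in> borel_measurable borel"
  shows "(\<integral>\<^sup>+i. f i \<partial>convex_comb a x y) = ennreal a * (\<integral>\<^sup>+i. f i \<partial>x) + ennreal (1 - a) * (\<integral>\<^sup>+i. f i \<partial>y)"
proof -
  have K: "(\<lambda>b. if b then x else y) \<in> measure_pmf (bernoulli_pmf a) \<rightarrow>\<^sub>M subprob_algebra borel"
    using x y by (auto simp: space_subprob_algebra Delta_iff prob_space_imp_subprob_space)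
  show ?thesis
    unfolding convex_comb_eq_bind nn_integral_bind[OF assms K]
    using a by (simp add: nn_integral_bernoulli_pmf mult.commute)
qed

lemma emeasure_convex_comb:
  assumes "A \<in> sets borel"
  shows "emeasure (convex_comb a x y) A = ennreal a * emeasure x A + ennreal (1 - a) * emeasure y A"
proof -
  have "sets x = sets borel" "sets y = sets borel" "sets (convex_comb a x y) = sets borel"
    using x y convex_comb_in_Delta by (auto simp: Delta_iff)
  then show ?thesis
    using nn_integral_convex_comb[of "indicator A"] assms by simp
qed

end

lemma integral_Delta_measurable:
  fixes f :: "'a::topological_space \<Rightarrow> 'b::topological_space \<Rightarrow> real"
  assumes x: "x \<in> Delta" and f: "(\<lambda>(i, j). f i j) \<in> borel_measurable (borel \<Otimes>\<^sub>M borel)"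
  shows "(\<lambda>j. \<integral>i. f i j \<partial>x) \<in> borel_measurable borel"
proof -
  interpret prob_space x
    using x by (simp add: Delta_iff)
  have sets_eq: "sets (borel \<Otimes>\<^sub>M x) = sets (borel \<Otimes>\<^sub>M borel)"
    using x by (intro sets_pair_measure_cong) (auto simp: Delta_iff)
  have "(\<lambda>(j, i). f i j) \<in> borel_measurable (borel \<Otimes>\<^sub>M x)"
    using measurable_compose[OF measurable_pair_swap' f]
    by (simp add: case_prod_unfold measurable_cong_sets[OF sets_eq refl])
  then show ?thesis
    by (rule borel_measurable_lebesgue_integral)
qed

lemma mixed_trans_nonneg: "0 \<le> mixed_trans G w x j"
  unfolding mixed_trans_def by simp

locale bounded_game =
  fixes G :: "('w::finite, 'i::topological_space, 'j::topological_space) absorbing_game"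
  assumes trans_measurable: "\<And>w. (\<lambda>(i, j). pmf (trans G i j) w) \<in> borel_measurable (borel \<Otimes>\<^sub>M borel)"
    and pay_measurable: "(\<lambda>(i, j). pay G i j) \<in> borel_measurable (borel \<Otimes>\<^sub>M borel)"
    and pay_le: "\<And>i j. \<bar>pay G i j\<bar> \<le> 1" and abs_pay_le: "\<And>w. \<bar>abs_pay G w\<bar> \<le> 1"
begin

lemma trans_section: "(\<lambda>i. pmf (trans G i j) w) \<in> borel_measurable borel"
  using measurable_compose[OF _ trans_measurable[of w], of "\<lambda>i. (i, j)" borel] by simp

lemma pay_section: "(\<lambda>i. pay G i j) \<in> borel_measurable borel"
  using measurable_compose[OF _ pay_measurable, of "\<lambda>i. (i, j)" borel] by simp

context
  fixes x :: "'i measure"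
  assumes x: "x \<in> Delta"
begin

interpretation prob_space x
  using x by (simp add: Delta_iff)

lemma measurable_x: "borel_measurable x = borel_measurable borel"
  using x by (intro measurable_cong_sets) (auto simp: Delta_iff)

lemma trans_integrable: "integrable x (\<lambda>i. pmf (trans G i j) w)"
  by (rule integrable_const_bound[of _ 1]) (auto simp: pmf_le_1 trans_section measurable_x)

lemma pay_integrable: "integrable x (\<lambda>i. pay G i j)"
  by (rule integrable_const_bound[of _ 1]) (auto simp: pay_le pay_section measurable_x)

lemma nn_integral_trans: "(\<integral>\<^sup>+i. ennreal (pmf (trans G i j) w) \<partial>x) = ennreal (mixed_trans G w x j)"
  unfolding mixed_trans_def by (intro nn_integral_eq_integral trans_integrable) simp

lemma sum_mixed_trans: "(\<Sum>w\<in>UNIV - {nonabs G}. mixed_trans G w x j) = 1 - mixed_trans G (nonabs G) x j"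
proof -
  have "(\<Sum>w\<in>UNIV. mixed_trans G w x j) = (\<integral>i. (\<Sum>w\<in>UNIV. pmf (trans G i j) w) \<partial>x)"
    unfolding mixed_trans_def by (intro Bochner_Integration.integral_sum[symmetric] trans_integrable)
  also have "\<dots> = 1"
    by (simp add: sum_pmf_eq_1 prob_space)
  finally show ?thesis
    by (simp add: sum_diff1)
qed

lemma mixed_trans_le_1: "mixed_trans G (nonabs G) x j \<le> 1"
proof -
  have "0 \<le> (\<Sum>w\<in>UNIV - {nonabs G}. mixed_trans G w x j)"
    by (intro sum_nonneg mixed_trans_nonneg)
  then show ?thesis
    using sum_mixed_trans by simp
qed

lemma g_sharp_abs_le: "\<bar>g_sharp G x j\<bar> \<le> 1 - mixed_trans G (nonabs G) x j"
proof -
  have "\<bar>g_sharp G x j\<bar> \<le> (\<Sum>w\<in>UNIV - {nonabs G}. \<bar>abs_pay G w * mixed_trans G w x j\<bar>)"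
    unfolding g_sharp_def by (rule sum_abs)
  also have "\<dots> \<le> (\<Sum>w\<in>UNIV - {nonabs G}. 1 * mixed_trans G w x j)"
    unfolding abs_mult using abs_pay_le mixed_trans_nonneg
    by (intro sum_mono mult_mono) auto
  finally show ?thesis
    by (simp add: sum_mixed_trans)
qed

lemma mixed_pay_abs_le: "\<bar>mixed_pay G x j\<bar> \<le> 1"
proof -
  have "\<bar>mixed_pay G x j\<bar> \<le> (\<integral>i. \<bar>pay G i j\<bar> \<partial>x)"
    unfolding mixed_pay_def by (rule integral_abs_bound)
  also have "\<dots> \<le> (\<integral>i. 1 \<partial>x)"
    using pay_le by (intro integral_mono) (auto intro: pay_integrable)
  finally show ?thesis
    by (simp add: prob_space)
qed

end

text \<open>Absorbing payoffs enter shifted by 1, hence nonnegative. Its mean under x is therefore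
  \<open>g_sharp\<close> plus the absorption probability, not \<open>g_sharp\<close> alone.\<close>

definition absorbing_gain :: "'i \<Rightarrow> 'j \<Rightarrow> real" where
  "absorbing_gain i j = (\<Sum>w\<in>UNIV - {nonabs G}. (1 + abs_pay G w) * pmf (trans G i j) w)"

lemma absorbing_gain_nonneg: "0 \<le> absorbing_gain i j"
proof -
  have "0 \<le> 1 + abs_pay G w" for w
    using abs_pay_le[of w] by linarith
  then show ?thesis
    unfolding absorbing_gain_def by (intro sum_nonneg mult_nonneg_nonneg) auto
qed

lemma absorbing_gain_measurable:
  "(\<lambda>y. absorbing_gain (fst y) (snd y)) \<in> borel_measurable (borel \<Otimes>\<^sub>M borel)"
  unfolding absorbing_gain_def using trans_measurable by (simp add: case_prod_unfold)

lemma nn_integral_gain: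
  assumes x: "x \<in> Delta" and c: "0 \<le> c"
  shows "(\<integral>\<^sup>+i. ennreal (1 + pay G i j + c * absorbing_gain i j) \<partial>x)
    = ennreal (1 + mixed_pay G x j + c * (g_sharp G x j + (1 - mixed_trans G (nonabs G) x j)))"
proof -
  interpret prob_space x
    using x by (simp add: Delta_iff)
  have gain: "integrable x (\<lambda>i. absorbing_gain i j)"
    unfolding absorbing_gain_def by (intro Bochner_Integration.integrable_sum integrable_mult_right trans_integrable[OF x])
  have "(\<integral>i. absorbing_gain i j \<partial>x) = (\<Sum>w\<in>UNIV - {nonabs G}. (1 + abs_pay G w) * mixed_trans G w x j)"
    unfolding absorbing_gain_def mixed_trans_def
    by (subst Bochner_Integration.integral_sum) (auto intro!: trans_integrable[OF x])
  also have "\<dots> = g_sharp G x j + (1 - mixed_trans G (nonabs G) x j)"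
    by (simp add: g_sharp_def algebra_simps sum.distrib sum_mixed_trans[OF x])
  finally have *: "(\<integral>i. absorbing_gain i j \<partial>x) = g_sharp G x j + (1 - mixed_trans G (nonabs G) x j)" .
  have "0 \<le> 1 + pay G i j" for i
    using pay_le[of i j] by (simp add: abs_le_iff)
  then have "(\<integral>\<^sup>+i. ennreal (1 + pay G i j + c * absorbing_gain i j) \<partial>x)
      = ennreal (\<integral>i. 1 + pay G i j + c * absorbing_gain i j \<partial>x)"
    using absorbing_gain_nonneg c gain pay_integrable[OF x]
    by (intro nn_integral_eq_integral) auto
  also have "(\<integral>i. 1 + pay G i j + c * absorbing_gain i j \<partial>x)
      = 1 + mixed_pay G x j + c * (\<integral>i. absorbing_gain i j \<partial>x)"
    using gain pay_integrable[OF x] by (simp add: mixed_pay_def prob_space)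
  finally show ?thesis
    by (simp add: *)
qed

end

locale bounded_play = absorbing_play G \<sigma> \<tau> + bounded_game G for G \<sigma> \<tau>
begin

section \<open>Stage values decomposed by the time of absorption\<close>

lemma stage_payoff_measurable[measurable]: "(\<lambda>p. stage_payoff G (p n)) \<in> borel_measurable \<P>"
proof -
  have "stage_payoff G \<in> borel_measurable stage_space"
    unfolding stage_payoff_def case_prod_unfold by measurable
  from measurable_compose[OF measurable_play_component this] show ?thesis .
qed

lemma stage_payoff_abs_le: "\<bar>stage_payoff G y\<bar> \<le> 1"
  using pay_le abs_pay_le by (auto simp: stage_payoff_def split: prod.split)

lemma stage_payoff_integrable: "integrable \<P> (\<lambda>p. stage_payoff G (p n))"
proof -
  interpret prob_space \<P> by (rule prob_space_play)
  show ?thesis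
    by (rule integrable_const_bound[of _ 1]) (auto simp: stage_payoff_abs_le)
qed

definition stage_value :: "nat \<Rightarrow> real" where
  "stage_value n = (\<integral>p. stage_payoff G (p n) \<partial>\<P>)"

lemma stage_value_abs_le: "\<bar>stage_value n\<bar> \<le> 1"
proof -
  interpret prob_space \<P> by (rule prob_space_play)
  have "\<bar>stage_value n\<bar> \<le> (\<integral>p. \<bar>stage_payoff G (p n)\<bar> \<partial>\<P>)"
    unfolding stage_value_def by (rule integral_abs_bound)
  also have "\<dots> \<le> (\<integral>p. 1 \<partial>\<P>)"
    using stage_payoff_integrable by (intro integral_mono) (auto simp: stage_payoff_abs_le)
  finally show ?thesis
    by (simp add: prob_space)
qed

lemma nn_integral_stage_payoff: "(\<integral>\<^sup>+p. ennreal (1 + stage_payoff G (p n)) \<partial>\<P>) = ennreal (1 + stage_value n)"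
proof -
  interpret prob_space \<P> by (rule prob_space_play)
  have "0 \<le> 1 + stage_payoff G y" for y
    using stage_payoff_abs_le[of y] by (simp add: abs_le_iff)
  then have "(\<integral>\<^sup>+p. ennreal (1 + stage_payoff G (p n)) \<partial>\<P>) = ennreal (\<integral>p. 1 + stage_payoff G (p n) \<partial>\<P>)"
    using stage_payoff_integrable by (intro nn_integral_eq_integral) auto
  then show ?thesis
    using stage_payoff_integrable by (simp add: stage_value_def prob_space)
qed

lemma live_integrand_measurable:
  assumes "(\<lambda>y. c (fst y) (snd y)) \<in> borel_measurable (borel \<Otimes>\<^sub>M borel)"
  shows "(\<lambda>p. indicator {nonabs G} (fst (p n)) * c (fst (snd (p n))) (snd (snd (p n))) :: ennreal) \<in> borel_measurable \<P>"
proof -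
  have [measurable]: "(\<lambda>p. snd (p n)) \<in> \<P> \<rightarrow>\<^sub>M borel \<Otimes>\<^sub>M borel"
    by measurable
  from measurable_compose[OF this assms] show ?thesis
    by (intro borel_measurable_times_ennreal) simp_all
qed

lemma live_add:
  assumes "(\<lambda>y. c (fst y) (snd y)) \<in> borel_measurable (borel \<Otimes>\<^sub>M borel)"
    and "(\<lambda>y. d (fst y) (snd y)) \<in> borel_measurable (borel \<Otimes>\<^sub>M borel)"
  shows "live n (\<lambda>i j. c i j + d i j) = live n c + live n d"
  unfolding live_def distrib_left by (intro nn_integral_add live_integrand_measurable assms)

lemma live_cmult:
  assumes "(\<lambda>y. c (fst y) (snd y)) \<in> borel_measurable (borel \<Otimes>\<^sub>M borel)"
  shows "live n (\<lambda>i j. k * c i j) = k * live n c"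
  unfolding live_def mult.left_commute[of _ k] by (intro nn_integral_cmult live_integrand_measurable assms)

lemma live_sum:
  assumes "\<And>w. (\<lambda>y. c w (fst y) (snd y)) \<in> borel_measurable (borel \<Otimes>\<^sub>M borel)"
  shows "live n (\<lambda>i j. \<Sum>w\<in>W. c w i j) = (\<Sum>w\<in>W. live n (c w))"
  unfolding live_def sum_distrib_left by (intro nn_integral_sum live_integrand_measurable assms)

text \<open>An absorbing state is entered at most once and never left, and the play starts outside
  it, so its probability is the sum over the possible entry stages.\<close>

lemma nn_integral_absorbed:
  assumes w: "w \<noteq> nonabs G"
  shows "(\<integral>\<^sup>+p. indicator {w} (fst (p n)) \<partial>\<P>) = (\<Sum>t<n. live t (\<lambda>i j. ennreal (pmf (trans G i j) w)))"
proof -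
  have state: "(\<integral>\<^sup>+p. indicator {w} (fst (p n)) \<partial>\<P>) = (\<integral>\<^sup>+p. ennreal (pmf (next_state G n p) w) \<partial>\<P>)" for n
  proof -
    have "(\<integral>\<^sup>+p. indicator {w} (fst (p n)) * 1 \<partial>\<P>) =
      (\<integral>\<^sup>+p. (\<integral>\<^sup>+v. indicator {w} v \<partial>next_state G n p) *
         (\<integral>\<^sup>+j. (\<integral>\<^sup>+i. 1 \<partial>\<sigma> n (actions n p)) \<partial>\<tau> n (actions n p)) \<partial>\<P>)"
      by (rule nn_integral_stage) simp
    moreover have "(\<integral>\<^sup>+j. (\<integral>\<^sup>+i. 1 \<partial>\<sigma> n (actions n p)) \<partial>\<tau> n (actions n p)) = 1" for p :: "nat \<Rightarrow> 'a \<times> 'b \<times> 'c"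
      using prob_space.emeasure_space_1[OF strategy_prob(1)[OF actions_in_space[of n p]]]
        prob_space.emeasure_space_1[OF strategy_prob(2)[OF actions_in_space[of n p]]] by simp
    ultimately show ?thesis
      by (simp add: nn_integral_indicator_next_state del: nn_integral_const nn_integral_indicator)
  qed
  show ?thesis
  proof (induction n)
    case 0
    then show ?case
      unfolding state using w by (simp add: next_state_def)
  next
    case (Suc n)
    have "(\<integral>\<^sup>+p. indicator {w} (fst (p (Suc n))) \<partial>\<P>)
      = (\<integral>\<^sup>+p. indicator {w} (fst (p n)) + indicator {nonabs G} (fst (p n)) *
          ennreal (pmf (trans G (fst (snd (p n))) (snd (snd (p n)))) w) \<partial>\<P>)"
      unfolding state pmf_next_state_Suc using w
      by (intro nn_integral_cong) (auto split: split_indicator)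
    also have "\<dots> = (\<integral>\<^sup>+p. indicator {w} (fst (p n)) \<partial>\<P>) + live n (\<lambda>i j. ennreal (pmf (trans G i j) w))"
      unfolding live_def
      by (intro nn_integral_add live_integrand_measurable) simp_all
    finally show ?case
      by (simp add: Suc)
  qed
qed

lemma stage_value_eq:
  "ennreal (1 + stage_value n) = live n (\<lambda>i j. ennreal (1 + pay G i j))
     + (\<Sum>t<n. live t (\<lambda>i j. ennreal (absorbing_gain i j)))"
proof -
  let ?W = "UNIV - {nonabs G}"
  have nonneg: "0 \<le> 1 + abs_pay G w" for w
    using abs_pay_le[of w] by (simp add: abs_le_iff)
  have gain: "live t (\<lambda>i j. ennreal (absorbing_gain i j))
      = (\<Sum>w\<in>?W. ennreal (1 + abs_pay G w) * live t (\<lambda>i j. ennreal (pmf (trans G i j) w)))" for t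
  proof -
    have "(\<lambda>i j. ennreal (absorbing_gain i j))
       = (\<lambda>i j. \<Sum>w\<in>?W. ennreal (1 + abs_pay G w) * ennreal (pmf (trans G i j) w))"
      by (auto simp: absorbing_gain_def nonneg ennreal_mult sum_ennreal[symmetric] intro!: ext sum.cong)
    then show ?thesis
      by (simp add: live_sum live_cmult)
  qed
  have "ennreal (1 + stage_value n) = (\<integral>\<^sup>+p. indicator {nonabs G} (fst (p n)) *
      ennreal (1 + pay G (fst (snd (p n))) (snd (snd (p n)))) +
      (\<Sum>w\<in>?W. ennreal (1 + abs_pay G w) * indicator {w} (fst (p n))) \<partial>\<P>)"
    unfolding nn_integral_stage_payoff[symmetric]
  proof (intro nn_integral_cong)
    fix p :: "nat \<Rightarrow> 'a \<times> 'b \<times> 'c"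
    obtain w i j where p: "p n = (w, i, j)"
      by (metis prod_cases3)
    have "(\<Sum>v\<in>?W. ennreal (1 + abs_pay G v) * indicator {v} w)
        = (\<Sum>v\<in>?W. if v = w then ennreal (1 + abs_pay G v) else 0)"
      by (intro sum.cong) (auto split: split_indicator)
    then show "ennreal (1 + stage_payoff G (p n)) = indicator {nonabs G} (fst (p n)) *
      ennreal (1 + pay G (fst (snd (p n))) (snd (snd (p n)))) +
      (\<Sum>w\<in>?W. ennreal (1 + abs_pay G w) * indicator {w} (fst (p n)))"
      by (simp add: p stage_payoff_def)
  qed
  also have "\<dots> = live n (\<lambda>i j. ennreal (1 + pay G i j)) +
      (\<Sum>w\<in>?W. \<integral>\<^sup>+p. ennreal (1 + abs_pay G w) * indicator {w} (fst (p n)) \<partial>\<P>)"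
  proof -
    have swap: "(\<integral>\<^sup>+p. (\<Sum>w\<in>?W. ennreal (1 + abs_pay G w) * indicator {w} (fst (p n))) \<partial>\<P>)
        = (\<Sum>w\<in>?W. \<integral>\<^sup>+p. ennreal (1 + abs_pay G w) * indicator {w} (fst (p n)) \<partial>\<P>)"
      by (rule nn_integral_sum) simp
    then show ?thesis
      unfolding live_def by (simp only: flip: swap) (intro nn_integral_add live_integrand_measurable, simp_all)
  qed
  also have "(\<Sum>w\<in>?W. \<integral>\<^sup>+p. ennreal (1 + abs_pay G w) * indicator {w} (fst (p n)) \<partial>\<P>)
      = (\<Sum>w\<in>?W. \<Sum>t<n. ennreal (1 + abs_pay G w) * live t (\<lambda>i j. ennreal (pmf (trans G i j) w)))"
    by (intro sum.cong refl) (simp add: nn_integral_cmult nn_integral_absorbed sum_distrib_left)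
  also have "\<dots> = (\<Sum>t<n. live t (\<lambda>i j. ennreal (absorbing_gain i j)))"
    unfolding gain by (rule sum.swap)
  finally show ?thesis .
qed

text \<open>Summing \<open>stage_value_eq\<close> over stages, the gain of an absorption at index t
  appears once for each of the T - 1 - t later indices below T.\<close>

lemma sum_stage_value_eq:
  "ennreal (\<Sum>n<T. 1 + stage_value n)
     = (\<Sum>t<T. live t (\<lambda>i j. ennreal (1 + pay G i j + real (T - 1 - t) * absorbing_gain i j)))"
proof -
  have nonneg: "0 \<le> 1 + pay G i j" for i j
    using pay_le[of i j] by (simp add: abs_le_iff)
  have "ennreal (\<Sum>n<T. 1 + stage_value n) = (\<Sum>n<T. ennreal (1 + stage_value n))"
  proof (intro sum_ennreal[symmetric])
    show "0 \<le> 1 + stage_value n" for n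
      using stage_value_abs_le[of n] by linarith
  qed
  also have "\<dots> = (\<Sum>t<T. live t (\<lambda>i j. ennreal (1 + pay G i j)))
      + (\<Sum>n<T. \<Sum>t<n. live t (\<lambda>i j. ennreal (absorbing_gain i j)))"
    unfolding stage_value_eq by (rule sum.distrib)
  also have "(\<Sum>n<T. \<Sum>t<n. live t (\<lambda>i j. ennreal (absorbing_gain i j)))
      = (\<Sum>t<T. of_nat (T - 1 - t) * live t (\<lambda>i j. ennreal (absorbing_gain i j)))"
    by (rule sum_weighted_eq_sum_partial_sums[symmetric])
  also have "(\<Sum>t<T. live t (\<lambda>i j. ennreal (1 + pay G i j))) + \<dots>
      = (\<Sum>t<T. live t (\<lambda>i j. ennreal (1 + pay G i j) + of_nat (T - 1 - t) * ennreal (absorbing_gain i j)))"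
    using absorbing_gain_measurable
    by (subst live_add) (simp_all add: live_cmult sum.distrib)
  also have "\<dots> = (\<Sum>t<T. live t (\<lambda>i j. ennreal (1 + pay G i j + real (T - 1 - t) * absorbing_gain i j)))"
    using nonneg absorbing_gain_nonneg
    by (simp add: ennreal_plus ennreal_mult ennreal_of_nat_eq_real_of_nat del: of_nat_diff)
  finally show ?thesis .
qed

lemma gamma_T_eq: "gamma_T G T \<sigma> \<tau> = (\<Sum>n<T. stage_value n) / real T"
  unfolding gamma_T_def stage_value_def
  using stage_payoff_integrable by (simp add: Bochner_Integration.integral_sum)

lemma gamma_disc_sums:
  assumes l: "0 < l" "l < 1"
  shows "(\<lambda>n. l * (1 - l) ^ n * stage_value n) sums gamma_disc G l \<sigma> \<tau>"
proof -
  have geo: "summable (\<lambda>n. l * (1 - l) ^ n)"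
    using l by (intro summable_mult summable_geometric) simp
  have bound: "norm (l * (1 - l) ^ n * stage_payoff G y) \<le> l * (1 - l) ^ n" for n y
    using l stage_payoff_abs_le[of y] mult_left_mono[of "\<bar>stage_payoff G y\<bar>" 1 "l * (1 - l) ^ n"]
    by (simp add: abs_mult)
  interpret prob_space \<P> by (rule prob_space_play)
  have int: "integrable \<P> (\<lambda>p. l * (1 - l) ^ n * stage_payoff G (p n))" for n
    using stage_payoff_integrable by simp
  have norm_le: "(\<integral>p. norm (l * (1 - l) ^ n * stage_payoff G (p n)) \<partial>\<P>) \<le> l * (1 - l) ^ n" for n
  proof -
    have "(\<integral>p. norm (l * (1 - l) ^ n * stage_payoff G (p n)) \<partial>\<P>) \<le> (\<integral>p. l * (1 - l) ^ n \<partial>\<P>)"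
      by (intro integral_mono integrable_norm int bound) simp
    then show ?thesis
      by (simp add: prob_space)
  qed
  have "(\<lambda>n. \<integral>p. l * (1 - l) ^ n * stage_payoff G (p n) \<partial>\<P>) sums
      (\<integral>p. (\<Sum>n. l * (1 - l) ^ n * stage_payoff G (p n)) \<partial>\<P>)"
  proof (rule sums_integral)
    show "AE p in \<P>. summable (\<lambda>n. norm (l * (1 - l) ^ n * stage_payoff G (p n)))"
      using bound by (intro AE_I2 summable_comparison_test'[OF geo]) simp
    show "summable (\<lambda>n. \<integral>p. norm (l * (1 - l) ^ n * stage_payoff G (p n)) \<partial>\<P>)"
      using norm_le by (intro summable_comparison_test'[OF geo]) simp
  qed (rule int)
  then show ?thesis
    by (simp add: gamma_disc_def stage_value_def)
qed

text \<open>A real infimum bounds its members only over a set that is bounded below; this supplies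
  the bound for the infimum in \<open>optimal_stationary\<close>.\<close>

lemma gamma_disc_ge:
  assumes l: "0 < l" "l < 1"
  shows "- 1 \<le> gamma_disc G l \<sigma> \<tau>"
proof (rule sums_le)
  have "(\<lambda>n. - (l * (1 - l) ^ n)) sums - (l * (1 / (1 - (1 - l))))"
    using l by (intro sums_minus sums_mult geometric_sums) simp
  then show "(\<lambda>n. - (l * (1 - l) ^ n)) sums - 1"
    using l by simp
  show "- (l * (1 - l) ^ n) \<le> l * (1 - l) ^ n * stage_value n" for n
    using l stage_value_abs_le[of n] mult_left_mono[of "- 1" "stage_value n" "l * (1 - l) ^ n"]
    by (simp add: abs_le_iff)
qed (rule gamma_disc_sums[OF l])

end

section \<open>Optimality in discounted games\<close>

lemma stationary_in_behavior: "x \<in> Delta \<Longrightarrow> stationary x \<in> behavior_strategies"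
  by (auto simp: behavior_strategies_def stationary_def)

lemma return_in_Delta: "return borel j \<in> Delta"
  by (auto simp: Delta_iff prob_space_return)

context bounded_game
begin

lemma bounded_playI: "\<sigma> \<in> behavior_strategies \<Longrightarrow> \<tau> \<in> behavior_strategies \<Longrightarrow> bounded_play G \<sigma> \<tau>"
  using trans_measurable pay_measurable bounded_game_axioms
  by (intro bounded_play.intro absorbing_play.intro)

context
  fixes x :: "'i measure" and j :: 'j
  assumes x: "x \<in> Delta"
begin

interpretation bounded_play G "stationary x" "stationary (return borel j)"
  using x by (intro bounded_playI stationary_in_behavior return_in_Delta)

lemma nn_integral_stationary:
  assumes c: "(\<lambda>y. c (fst y) (snd y)) \<in> borel_measurable (borel \<Otimes>\<^sub>M borel)"
  shows "(\<integral>\<^sup>+j'. (\<integral>\<^sup>+i. c i j' \<partial>stationary x n h) \<partial>stationary (return borel j) n h) = (\<integral>\<^sup>+i. c i j \<partial>x)"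
proof -
  have "(\<lambda>j'. \<integral>\<^sup>+i. c i j' \<partial>x) \<in> borel_measurable borel"
    \<comment> \<open>The kernel is the same at every stage, so stage 0 suffices; its only history
      is the constant \<open>undefined\<close>.\<close>
    using measurable_compose[OF _ kernel_measurable(1)[OF measurable_ignore_history[OF c, of 0]],
        of "\<lambda>j'. (\<lambda>_. undefined, j')" borel]
    by (simp add: stationary_def space_PiM)
  then show ?thesis
    by (simp add: stationary_def nn_integral_return)
qed

text \<open>Both players use fixed laws, so every stage multiplies the survival probability by the
  same factor, independently of the past.\<close>

lemma live_stationary:
  assumes c: "(\<lambda>y. c (fst y) (snd y)) \<in> borel_measurable (borel \<Otimes>\<^sub>M borel)"
  shows "live n c = ennreal (mixed_trans G (nonabs G) x j) ^ n * (\<integral>\<^sup>+i. c i j \<partial>x)"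
proof -
  let ?S = "\<lambda>n h. \<Prod>s<n. stay (fst (h s)) (snd (h s))"
  have "(\<integral>\<^sup>+p. ?S n (actions n p) \<partial>\<P>) = ennreal (mixed_trans G (nonabs G) x j) ^ n"
  proof (induction n)
    case 0
    interpret prob_space \<P> by (rule prob_space_play)
    show ?case
      by (simp add: emeasure_space_1)
  next
    case (Suc n)
    have f: "(\<lambda>(h, y). ?S n h * stay (fst y) (snd y)) \<in> borel_measurable (history_space n \<Otimes>\<^sub>M (borel \<Otimes>\<^sub>M borel))"
      using measurable_compose[OF measurable_fst measurable_prod_stay]
        measurable_compose[OF measurable_snd stay_measurable]
      unfolding case_prod_unfold by (intro borel_measurable_times_ennreal)
    have inner: "(\<integral>\<^sup>+j'. (\<integral>\<^sup>+i. ?S n h * stay i j' \<partial>stationary x n h) \<partial>stationary (return borel j) n h)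
        = ?S n h * ennreal (mixed_trans G (nonabs G) x j)" for h
    proof -
      have "(\<lambda>i. stay i j) \<in> borel_measurable x"
        using trans_section[of j "nonabs G"] by (simp add: measurable_x[OF x])
      then have "(\<integral>\<^sup>+i. ?S n h * stay i j \<partial>x) = ?S n h * ennreal (mixed_trans G (nonabs G) x j)"
        by (subst nn_integral_cmult) (simp_all add: nn_integral_trans[OF x])
      then show ?thesis
        by (subst nn_integral_stationary[of "\<lambda>i j. ?S n h * stay i j"])
           (auto intro!: borel_measurable_times_ennreal)
    qed
    have "(\<integral>\<^sup>+p. ?S (Suc n) (actions (Suc n) p) \<partial>\<P>)
        = (\<integral>\<^sup>+p. 1 * (?S n (actions n p) * stay (fst (snd (p n))) (snd (snd (p n)))) \<partial>\<P>)"
      by (intro nn_integral_cong) (auto simp: actions_Suc intro!: arg_cong2[where f="(*)"] prod.cong)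
    also have "\<dots> = (\<integral>\<^sup>+p. ?S n (actions n p) * ennreal (mixed_trans G (nonabs G) x j) \<partial>\<P>)"
      by (subst nn_integral_stage[OF f]) (simp only: inner, simp add: measure_pmf.emeasure_space_1[simplified])
    also have "\<dots> = (\<integral>\<^sup>+p. ?S n (actions n p) \<partial>\<P>) * ennreal (mixed_trans G (nonabs G) x j)"
      by (rule nn_integral_multc) (rule measurable_compose[OF measurable_play_actions measurable_prod_stay])
    finally show ?case
      by (simp add: Suc mult.commute)
  qed
  then show ?thesis
    unfolding live_eq[OF c] nn_integral_stationary[OF c]
    by (subst nn_integral_multc[OF measurable_compose[OF measurable_play_actions measurable_prod_stay]]) simp
qed

lemma stage_value_stationary:
  "1 + stage_value n = mixed_trans G (nonabs G) x j ^ n * (1 + mixed_pay G x j)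
    + (\<Sum>t<n. mixed_trans G (nonabs G) x j ^ t * (g_sharp G x j + (1 - mixed_trans G (nonabs G) x j)))"
proof -
  let ?q = "mixed_trans G (nonabs G) x j"
  have q: "0 \<le> ?q"
    by (rule mixed_trans_nonneg)
  have pay: "0 \<le> 1 + mixed_pay G x j"
    using mixed_pay_abs_le[OF x, of j] by linarith
  have gain: "0 \<le> g_sharp G x j + (1 - ?q)"
    using g_sharp_abs_le[OF x, of j] by linarith
  \<comment> \<open>\<open>nn_integral_gain\<close> with weights 1 and 0 differs exactly by this
    integral; the finite payoff part cancels.\<close>
  have gain_eq: "(\<integral>\<^sup>+i. ennreal (absorbing_gain i j) \<partial>x) = ennreal (g_sharp G x j + (1 - ?q))"
  proof -
    have 1: "0 \<le> 1 + pay G i j" for i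
      using pay_le[of i j] by linarith
    interpret X: prob_space x
      using x by (simp add: Delta_iff)
    have m: "(\<lambda>i. absorbing_gain i j) \<in> borel_measurable x" "(\<lambda>i. 1 + pay G i j) \<in> borel_measurable x"
      using measurable_compose[OF _ absorbing_gain_measurable, of "\<lambda>i. (i, j)" borel] pay_section[of j]
      by (simp_all add: measurable_x[OF x])
    have "ennreal (1 + mixed_pay G x j) + (\<integral>\<^sup>+i. ennreal (absorbing_gain i j) \<partial>x)
        = (\<integral>\<^sup>+i. ennreal (1 + pay G i j + 1 * absorbing_gain i j) \<partial>x)"
      using m 1 absorbing_gain_nonneg nn_integral_gain[OF x, of 0 j]
      by (simp add: ennreal_plus nn_integral_add del: nn_integral_const)
    also have "\<dots> = ennreal (1 + mixed_pay G x j) + ennreal (g_sharp G x j + (1 - ?q))"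
      unfolding nn_integral_gain[OF x zero_le_one] using pay gain
      by (simp add: ennreal_plus[symmetric] del: ennreal_plus)
    finally show ?thesis
      by simp
  qed
  have "ennreal (1 + stage_value n) = ennreal (?q ^ n) * ennreal (1 + mixed_pay G x j)
      + (\<Sum>t<n. ennreal (?q ^ t) * ennreal (g_sharp G x j + (1 - ?q)))"
    unfolding stage_value_eq using q nn_integral_gain[OF x, of 0 j] absorbing_gain_measurable
    by (simp add: live_stationary gain_eq ennreal_power)
  also have "\<dots> = ennreal (?q ^ n * (1 + mixed_pay G x j) + (\<Sum>t<n. ?q ^ t * (g_sharp G x j + (1 - ?q))))"
  proof -
    have "(\<Sum>t<n. ennreal (?q ^ t) * ennreal (g_sharp G x j + (1 - ?q)))
        = ennreal (\<Sum>t<n. ?q ^ t * (g_sharp G x j + (1 - ?q)))"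
      using q gain by (subst sum_ennreal[symmetric]) (auto simp: ennreal_mult)
    moreover have "ennreal (?q ^ n) * ennreal (1 + mixed_pay G x j) = ennreal (?q ^ n * (1 + mixed_pay G x j))"
      using q pay by (simp add: ennreal_mult)
    moreover have "0 \<le> ?q ^ n * (1 + mixed_pay G x j)" "0 \<le> (\<Sum>t<n. ?q ^ t * (g_sharp G x j + (1 - ?q)))"
      using q pay gain by (auto intro!: mult_nonneg_nonneg sum_nonneg)
    ultimately show ?thesis
      by (simp only: ennreal_plus)
  qed
  finally show ?thesis
  proof (rule ennreal_inj[THEN iffD1, rotated 2])
    show "0 \<le> 1 + stage_value n"
      using stage_value_abs_le[of n] by linarith
    show "0 \<le> ?q ^ n * (1 + mixed_pay G x j) + (\<Sum>t<n. ?q ^ t * (g_sharp G x j + (1 - ?q)))"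
      using q pay gain by (auto intro!: add_nonneg_nonneg mult_nonneg_nonneg sum_nonneg)
  qed
qed

text \<open>Stage values satisfy s(n+1) = q s(n) + g#(j). Summed with discount weights this yields
  the one-step equation v = l g(x,j) + (1 - l) (q v + g#(j)), solved here without dividing.\<close>

lemma gamma_disc_stationary:
  assumes l: "0 < l" "l < 1"
  shows "gamma_disc G l (stationary x) (stationary (return borel j))
      * (l + (1 - l) * (1 - mixed_trans G (nonabs G) x j))
    = l * mixed_pay G x j + (1 - l) * g_sharp G x j"
proof -
  let ?q = "mixed_trans G (nonabs G) x j"
  let ?v = "gamma_disc G l (stationary x) (stationary (return borel j))"
  let ?F = "\<lambda>n. l * (1 - l) ^ n * stage_value n"
  have 0: "stage_value 0 = mixed_pay G x j"
    using stage_value_stationary[of 0] by simp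
  have Suc: "stage_value (Suc n) = ?q * stage_value n + g_sharp G x j" for n
  proof -
    have "1 + stage_value (Suc n) = ?q * (1 + stage_value n) + (g_sharp G x j + (1 - ?q))"
      unfolding stage_value_stationary
      by (simp add: sum.lessThan_Suc_shift sum_distrib_left algebra_simps del: sum.lessThan_Suc)
    then show ?thesis
      by (simp add: algebra_simps)
  qed
  have F: "?F sums ?v"
    by (rule gamma_disc_sums[OF l])
  have "(\<lambda>n. l * (1 - l) ^ n) sums (l * (1 / (1 - (1 - l))))"
    using l by (intro sums_mult geometric_sums) simp
  then have geo: "(\<lambda>n. l * (1 - l) ^ n) sums 1"
    using l by simp
  have "(\<lambda>n. (1 - l) * (?q * ?F n + g_sharp G x j * (l * (1 - l) ^ n))) sums
      ((1 - l) * (?q * ?v + g_sharp G x j * 1))"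
    by (intro sums_mult sums_add F geo)
  then have "(\<lambda>n. ?F (Suc n)) sums ((1 - l) * (?q * ?v + g_sharp G x j))"
    by (simp add: Suc algebra_simps)
  moreover have "(\<lambda>n. ?F (Suc n)) sums (?v - ?F 0)"
    using F by (subst sums_Suc_iff) simp
  ultimately have "?v - ?F 0 = (1 - l) * (?q * ?v + g_sharp G x j)"
    using sums_unique2 by blast
  then show ?thesis
    by (simp add: 0 algebra_simps)
qed

end

text \<open>The strategy x secures the discounted value against the constant reply j in particular,
  and \<open>gamma_disc_stationary\<close> computes that payoff.\<close>

lemma optimal_stationary_ge:
  assumes l: "0 < l" "l < 1" and opt: "optimal_stationary G l x"
  shows "disc_value G l * (l + (1 - l) * (1 - mixed_trans G (nonabs G) x j))
    \<le> l * mixed_pay G x j + (1 - l) * g_sharp G x j"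
proof -
  have x: "x \<in> Delta"
    using opt by (simp add: optimal_stationary_def)
  have "bdd_below ((\<lambda>\<tau>. gamma_disc G l (stationary x) \<tau>) ` behavior_strategies)"
  proof (rule bdd_belowI2)
    fix \<tau> :: "('i, 'j, 'j) strategy"
    assume "\<tau> \<in> behavior_strategies"
    then interpret bounded_play G "stationary x" \<tau>
      using x by (intro bounded_playI stationary_in_behavior)
    show "- 1 \<le> gamma_disc G l (stationary x) \<tau>"
      by (rule gamma_disc_ge[OF l])
  qed
  then have "disc_value G l \<le> gamma_disc G l (stationary x) (stationary (return borel j))"
    using opt unfolding optimal_stationary_def
    by (metis cINF_lower stationary_in_behavior return_in_Delta)
  moreover have "0 \<le> l + (1 - l) * (1 - mixed_trans G (nonabs G) x j)"
    using l mixed_trans_le_1[OF x, of j] by simp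
  ultimately show ?thesis
    unfolding gamma_disc_stationary[OF x l, symmetric] by (rule mult_right_mono)
qed

lemma mixed_trans_measurable: "x \<in> Delta \<Longrightarrow> (\<lambda>j. mixed_trans G w x j) \<in> borel_measurable borel"
  unfolding mixed_trans_def by (rule integral_Delta_measurable[OF _ trans_measurable])

lemma mixed_pay_measurable: "x \<in> Delta \<Longrightarrow> (\<lambda>j. mixed_pay G x j) \<in> borel_measurable borel"
  unfolding mixed_pay_def by (rule integral_Delta_measurable[OF _ pay_measurable])

text \<open>The limit of \<open>optimal_stationary_ge\<close> along the vanishing discount rates:
  the bounded stage payoff is multiplied by l k and disappears, and weak convergence applies to the
  transition probabilities, continuous in Player I's action. For v >= 0 it makes
  \<open>g_sharp\<close> at the limit nonnegative.\<close>

lemma g_sharp_limit_ge: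
  assumes cont: "\<And>w j. continuous_on UNIV (\<lambda>i. pmf (trans G i j) w)"
    and opt: "\<And>k. optimal_stationary G (l k) (x k)" and l: "\<And>k. 0 < l k" "\<And>k. l k < 1"
    and l0: "l \<longlonglongrightarrow> 0" and v: "(\<lambda>k. disc_value G (l k)) \<longlonglongrightarrow> v"
    and weak: "weakly_converges x x\<^sub>0"
  shows "v * (1 - mixed_trans G (nonabs G) x\<^sub>0 j) \<le> g_sharp G x\<^sub>0 j"
proof -
  have "bounded (range (\<lambda>i. pmf (trans G i j) w))" for w
    by (rule boundedI[of _ 1]) (auto simp: pmf_le_1)
  then have trans: "(\<lambda>k. mixed_trans G w (x k) j) \<longlonglongrightarrow> mixed_trans G w x\<^sub>0 j" for w
    using weak cont unfolding weakly_converges_def mixed_trans_def by blast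
  have sharp: "(\<lambda>k. g_sharp G (x k) j) \<longlonglongrightarrow> g_sharp G x\<^sub>0 j"
    unfolding g_sharp_def by (intro tendsto_sum tendsto_mult tendsto_const trans)
  have pay0: "(\<lambda>k. l k * mixed_pay G (x k) j) \<longlonglongrightarrow> 0"
  proof (rule tendsto_0_le[OF l0])
    show "\<forall>\<^sub>F k in sequentially. norm (l k * mixed_pay G (x k) j) \<le> norm (l k) * 1"
      using opt mixed_pay_abs_le unfolding optimal_stationary_def
      by (intro always_eventually allI) (simp add: abs_mult mult_left_le)
  qed
  have "(\<lambda>k. disc_value G (l k) * (l k + (1 - l k) * (1 - mixed_trans G (nonabs G) (x k) j)))
      \<longlonglongrightarrow> v * (0 + (1 - 0) * (1 - mixed_trans G (nonabs G) x\<^sub>0 j))"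
    by (intro tendsto_intros v l0 trans)
  moreover have "(\<lambda>k. l k * mixed_pay G (x k) j + (1 - l k) * g_sharp G (x k) j)
      \<longlonglongrightarrow> 0 + (1 - 0) * g_sharp G x\<^sub>0 j"
    by (intro tendsto_intros pay0 l0 sharp)
  ultimately have "v * (0 + (1 - 0) * (1 - mixed_trans G (nonabs G) x\<^sub>0 j)) \<le> 0 + (1 - 0) * g_sharp G x\<^sub>0 j"
    by (rule LIMSEQ_le) (use optimal_stationary_ge[OF l opt] in auto)
  then show ?thesis
    by simp
qed

end

section \<open>The regret-based strategy\<close>

declare alpha_seq.simps [simp del] a_seq.simps [simp del] R1_seq.simps [simp del] R2_seq.simps [simp del]

text \<open>The recursion at n reads only stages before n. Hence the strategy, which is handed
  restricted histories, plays the same weights as along the full sequence.\<close>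

lemma seq_cong:
  assumes "\<And>s. s < n \<Longrightarrow> h s = h' s"
  shows "alpha_seq G e xl x0 h n = alpha_seq G e xl x0 h' n \<and> a_seq G e xl x0 h n = a_seq G e xl x0 h' n"
  using assms
proof (induction n rule: less_induct)
  case (less n)
  have IH: "alpha_seq G e xl x0 h s = alpha_seq G e xl x0 h' s" "a_seq G e xl x0 h s = a_seq G e xl x0 h' s"
    if "s < n" for s
    using less.IH[OF that] less.prems that by auto
  have "R1_seq G e xl x0 h n = R1_seq G e xl x0 h' n" "R2_seq G e xl x0 h n = R2_seq G e xl x0 h' n"
    "alpha_seq G e xl x0 h n = alpha_seq G e xl x0 h' n"
    using IH less.prems
    by (auto simp: R1_seq.simps[of _ _ _ _ _ n] R2_seq.simps[of _ _ _ _ _ n] alpha_seq.simps[of _ _ _ _ _ n]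
        intro!: sum.cong prod.cong arg_cong[where f="max 0"])
  then show ?case
    by (simp add: a_seq.simps[of _ _ _ _ _ n])
qed

lemma a_seq_restrict: "a_seq G e xl x0 (restrict h {0..<n}) n = a_seq G e xl x0 h n"
  using seq_cong[of n "restrict h {0..<n}" h] by auto

text \<open>The map \<open>\<rho> \<mapsto> m\<^sup>2 R2 / (m R2 + \<rho> R1)\<close> is decreasing, so a supremum over ratios is its value at their infimum.\<close>

lemma SUP_ratio_eq:
  fixes f g :: "'a \<Rightarrow> real"
  assumes A: "A \<noteq> {}" and f: "\<And>j. j \<in> A \<Longrightarrow> f j < 0" and m: "0 < m" and R: "0 \<le> R1" "0 \<le> R2" "R1 \<noteq> 0 \<or> R2 \<noteq> 0"
    and \<kappa>: "0 < \<kappa>" "\<kappa> = (INF j\<in>A. g j / (- f j))" and bdd: "bdd_below ((\<lambda>j. g j / (- f j)) ` A)"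
  shows "(SUP j\<in>A. (m\<^sup>2 * f j * R2) / (m * f j * R2 - g j * R1)) = m\<^sup>2 * R2 / (m * R2 + \<kappa> * R1)"
proof -
  define \<rho> where "\<rho> j = g j / (- f j)" for j
  have \<rho>: "\<kappa> \<le> \<rho> j" if "j \<in> A" for j
    unfolding \<kappa>(2) \<rho>_def by (rule cINF_lower[OF bdd that])
  have pos: "0 < m * R2 + r * R1" if "0 < r" for r
    using R m that by (metis add_nonneg_pos add_pos_nonneg mult_pos_pos mult_nonneg_nonneg less_eq_real_def)
  have eq: "(m\<^sup>2 * f j * R2) / (m * f j * R2 - g j * R1) = m\<^sup>2 * R2 / (m * R2 + \<rho> j * R1)" if "j \<in> A" for j
  proof -
    have "m * f j * R2 - g j * R1 = f j * (m * R2 + \<rho> j * R1)"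
      using f[OF that] by (simp add: \<rho>_def field_simps)
    then show ?thesis
      using f[OF that] by (simp add: mult.left_commute[of _ "f j"] mult.assoc)
  qed
  have upper: "m\<^sup>2 * R2 / (m * R2 + \<rho> j * R1) \<le> m\<^sup>2 * R2 / (m * R2 + \<kappa> * R1)" if "j \<in> A" for j
    using \<rho>[OF that] pos[OF \<kappa>(1)] R m by (intro divide_left_mono add_left_mono mult_right_mono mult_pos_pos)
      (auto intro: pos less_le_trans[OF \<kappa>(1)])
  let ?S = "SUP j\<in>A. m\<^sup>2 * R2 / (m * R2 + \<rho> j * R1)"
  have le_S: "m\<^sup>2 * R2 / (m * R2 + \<rho> j * R1) \<le> ?S" if "j \<in> A" for j
    using upper that by (intro cSUP_upper bdd_aboveI2[of _ _ "m\<^sup>2 * R2 / (m * R2 + \<kappa> * R1)"]) auto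
  obtain j0 where j0: "j0 \<in> A"
    using A by blast
  have "?S = m\<^sup>2 * R2 / (m * R2 + \<kappa> * R1)"
  proof (rule antisym)
    show "?S \<le> m\<^sup>2 * R2 / (m * R2 + \<kappa> * R1)"
      by (rule cSUP_least[OF A upper])
    show "m\<^sup>2 * R2 / (m * R2 + \<kappa> * R1) \<le> ?S"
    proof (cases "R1 = 0 \<or> R2 = 0")
      \<comment> \<open>If one regret vanishes, the ratio no longer depends on
        \<open>\<rho> j\<close>, and any j attains the value.\<close>
      case True
      then show ?thesis
        using le_S[OF j0] by auto
    next
      case False
      then have R': "0 < R1" "0 < R2"
        using R by auto
      have "0 < m\<^sup>2 * R2 / (m * R2 + \<rho> j0 * R1)"
        using R' m pos[OF less_le_trans[OF \<kappa>(1) \<rho>[OF j0]]] by simp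
      then have S: "0 < ?S"
        using le_S[OF j0] by linarith
      \<comment> \<open>The infimum need not be attained. Solving the bound by \<open>?S\<close> for
        \<open>\<rho> j\<close> gives a common lower bound of all ratios, hence of
        \<open>\<kappa>\<close>; solving back gives the claim.\<close>
      have "(m\<^sup>2 * R2 / ?S - m * R2) / R1 \<le> \<kappa>"
        unfolding \<kappa>(2)
      proof (rule cINF_greatest[OF A])
        fix j
        assume j: "j \<in> A"
        have "m\<^sup>2 * R2 \<le> ?S * (m * R2 + \<rho> j * R1)"
          using le_S[OF j] pos[OF less_le_trans[OF \<kappa>(1) \<rho>[OF j]]] by (simp add: pos_divide_le_eq)
        then have "m\<^sup>2 * R2 / ?S \<le> m * R2 + \<rho> j * R1"
          using S by (simp add: pos_divide_le_eq mult.commute)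
        then show "(m\<^sup>2 * R2 / ?S - m * R2) / R1 \<le> g j / (- f j)"
          using R' by (simp add: pos_divide_le_eq \<rho>_def)
      qed
      then have "m\<^sup>2 * R2 / ?S \<le> m * R2 + \<kappa> * R1"
        using R' by (simp add: pos_divide_le_eq)
      then show ?thesis
        using S pos[OF \<kappa>(1)] by (simp add: pos_divide_le_eq mult.commute)
    qed
  qed
  moreover have "(SUP j\<in>A. (m\<^sup>2 * f j * R2) / (m * f j * R2 - g j * R1)) = ?S"
    by (rule SUP_cong[OF refl eq])
  ultimately show ?thesis
    by simp
qed

locale regret_game = bounded_game G
  for G :: "('w::finite, 'i::topological_space, 'j::topological_space) absorbing_game" +
  fixes e lam :: real and xl x0 :: "'i measure"
  assumes e: "0 < e" "e < 1 / 2" and lam: "0 < lam" "lam < 1"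
    and xl: "xl \<in> Delta" and x0: "x0 \<in> Delta"
    and sharp_flat: "\<And>j. 0 \<le> (1 - lam) * g_sharp G xl j + lam * g_flat G x0 j"
    and sharp_x0: "\<And>j. 0 \<le> g_sharp G x0 j"
    and pay_close: "\<And>j. \<bar>mixed_pay G x0 j - mixed_pay G xl j\<bar> \<le> e / 2"
    and flat_neg: "\<exists>j. g_flat G x0 j < 0"
begin

text \<open>The best exchange rate of absorbing against flat payoff: the largest k with g# >= k
  |gflat| wherever gflat is negative.\<close>

definition \<kappa> :: real where
  "\<kappa> = (INF j\<in>{j. g_flat G x0 j < 0}. g_sharp G xl j / (- g_flat G x0 j))"

lemma ratio_ge: "g_flat G x0 j < 0 \<Longrightarrow> lam / (1 - lam) \<le> g_sharp G xl j / (- g_flat G x0 j)"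
  using sharp_flat[of j] lam by (simp add: field_simps)

lemma ratio_bdd_below: "bdd_below ((\<lambda>j. g_sharp G xl j / (- g_flat G x0 j)) ` {j. g_flat G x0 j < 0})"
  using ratio_ge by (intro bdd_belowI2[of _ "lam / (1 - lam)"]) auto

lemma \<kappa>_ge: "lam / (1 - lam) \<le> \<kappa>"
  unfolding \<kappa>_def using flat_neg ratio_ge by (intro cINF_greatest) auto

lemma lam_le_\<kappa>: "lam \<le> \<kappa>"
proof -
  have "lam \<le> lam / (1 - lam)"
    using lam by (simp add: field_simps)
  then show ?thesis
    using \<kappa>_ge by simp
qed

text \<open>Where gflat is negative this is the definition of the infimum. Elsewhere it follows from
  the discounted inequality, because \<open>\<kappa>\<close> is at least lam / (1 - lam).\<close>

lemma sharp_\<kappa>: "0 \<le> g_sharp G xl j + \<kappa> * g_flat G x0 j"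
proof (cases "g_flat G x0 j < 0")
  case True
  then have "\<kappa> \<le> g_sharp G xl j / (- g_flat G x0 j)"
    unfolding \<kappa>_def by (intro cINF_lower[OF ratio_bdd_below]) simp
  then show ?thesis
    using True by (simp add: field_simps)
next
  case False
  have "- g_sharp G xl j \<le> lam / (1 - lam) * g_flat G x0 j"
    using sharp_flat[of j] lam by (simp add: field_simps)
  also have "\<dots> \<le> \<kappa> * g_flat G x0 j"
    using \<kappa>_ge False by (intro mult_right_mono) auto
  finally show ?thesis
    by simp
qed

lemma R_seq_nonneg: "0 \<le> R1_seq G e xl x0 h n" "0 \<le> R2_seq G e xl x0 h n"
  by (simp_all add: R1_seq.simps[of _ _ _ _ _ n] R2_seq.simps[of _ _ _ _ _ n])

text \<open>The default 0 for vanishing regrets agrees with the formula, as 0 / 0 = 0.\<close>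

lemma a_seq_eq:
  "a_seq G e xl x0 h n = (mu e n)\<^sup>2 * R2_seq G e xl x0 h n
     / (mu e n * R2_seq G e xl x0 h n + \<kappa> * R1_seq G e xl x0 h n)"
proof (cases "R1_seq G e xl x0 h n = 0 \<and> R2_seq G e xl x0 h n = 0")
  case False
  have "0 < \<kappa>"
    using lam_le_\<kappa> lam by simp
  then show ?thesis
    unfolding a_seq.simps[of _ _ _ _ _ n] using False flat_neg
    by (simp only: if_False, intro SUP_ratio_eq[OF _ _ _ _ _ _ _ \<kappa>_def ratio_bdd_below])
      (auto simp: mu_pos[OF e(1)] R_seq_nonneg)
qed (simp add: a_seq.simps[of _ _ _ _ _ n])

sublocale regret_path e lam \<kappa> "\<lambda>n. g_sharp G xl (snd (h n))" "\<lambda>n. g_flat G x0 (snd (h n))"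
  "\<lambda>n. mixed_pay G xl (snd (h n))" "\<lambda>n. g_sharp G x0 (snd (h n))"
  "\<lambda>n. mixed_trans G (nonabs G) xl (snd (h n))" "\<lambda>n. mixed_trans G (nonabs G) x0 (snd (h n))"
  "alpha_seq G e xl x0 h" "a_seq G e xl x0 h" "R1_seq G e xl x0 h" "R2_seq G e xl x0 h"
  for h
proof
  fix n
  show "g_flat G x0 (snd (h n)) - e / 2 \<le> mixed_pay G xl (snd (h n))"
    using pay_close[of "snd (h n)"] unfolding g_flat_def by linarith
  show "\<bar>g_flat G x0 (snd (h n))\<bar> \<le> 1"
    unfolding g_flat_def by (rule mixed_pay_abs_le[OF x0])
qed (use e lam lam_le_\<kappa> xl x0 in \<open>auto intro: mixed_trans_nonneg mixed_trans_le_1 g_sharp_abs_le sharp_x0 sharp_\<kappa>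
  alpha_seq.simps R1_seq.simps R2_seq.simps a_seq_eq\<close>)

lemma g_sharp_measurable: "g_sharp G xl \<in> borel_measurable borel"
  unfolding g_sharp_def[abs_def] using mixed_trans_measurable[OF xl] by simp

lemma g_flat_measurable: "g_flat G x0 \<in> borel_measurable borel"
  unfolding g_flat_def[abs_def] by (rule mixed_pay_measurable[OF x0])

text \<open>A supremum over uncountably many j of measurable functions of the history need not be
  measurable. By \<open>a_seq_eq\<close> the replies enter only through the number
  \<open>\<kappa>\<close>, so arithmetic of measurable functions suffices.\<close>

lemma seq_measurable:
  assumes "n \<le> m"
  shows "(\<lambda>h. alpha_seq G e xl x0 h n) \<in> borel_measurable (history_space m)
    \<and> (\<lambda>h. a_seq G e xl x0 h n) \<in> borel_measurable (history_space m)"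
  using assms
proof (induction n rule: less_induct)
  case (less n)
  have comp: "(\<lambda>h. f (snd (h s))) \<in> borel_measurable (history_space m)"
    if "s < n" "f \<in> borel_measurable borel" for s and f :: "'j \<Rightarrow> real"
  proof -
    have "(\<lambda>h. h s) \<in> history_space m \<rightarrow>\<^sub>M borel \<Otimes>\<^sub>M borel"
      using that less.prems by simp
    from measurable_compose[OF measurable_compose[OF this measurable_snd] that(2)] show ?thesis .
  qed
  have IH: "(\<lambda>h. alpha_seq G e xl x0 h s) \<in> borel_measurable (history_space m)"
    "(\<lambda>h. a_seq G e xl x0 h s) \<in> borel_measurable (history_space m)" if "s < n" for s
    using less.IH[OF that] that less.prems by auto
  note intros = borel_measurable_max borel_measurable_const borel_measurable_uminus borel_measurable_sum
    borel_measurable_prod borel_measurable_add borel_measurable_diff borel_measurable_times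
    borel_measurable_divide
  have "(\<lambda>h. R1_seq G e xl x0 h n) \<in> borel_measurable (history_space m)"
    unfolding R1_seq.simps[of _ _ _ _ _ n]
    by (intro intros IH comp g_sharp_measurable) simp_all
  moreover have "(\<lambda>h. R2_seq G e xl x0 h n) \<in> borel_measurable (history_space m)"
    unfolding R2_seq.simps[of _ _ _ _ _ n]
    by (intro intros IH comp g_flat_measurable) simp_all
  moreover have "(\<lambda>h. alpha_seq G e xl x0 h n) \<in> borel_measurable (history_space m)"
    unfolding alpha_seq.simps[of _ _ _ _ _ n]
    by (intro intros IH comp mixed_trans_measurable xl x0) simp_all
  ultimately show ?case
    unfolding a_seq_eq by (intro conjI intros)
qed

abbreviation \<sigma> :: "('i, 'j, 'i) strategy" where
  "\<sigma> \<equiv> sigma_star G e xl x0"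

lemma sigma_star_in_behavior: "\<sigma> \<in> behavior_strategies"
proof -
  have "\<sigma> n \<in> history_space n \<rightarrow>\<^sub>M prob_algebra borel" for n
  proof (rule measurable_prob_algebraI)
    have Delta: "\<sigma> n h \<in> Delta" for h
      unfolding sigma_star_def by (rule convex_comb_in_Delta[OF a_nonneg a_le_1 xl x0])
    then show "prob_space (\<sigma> n h)" for h
      by (simp add: Delta_iff)
    show "\<sigma> n \<in> history_space n \<rightarrow>\<^sub>M subprob_algebra borel"
    proof (rule measurable_subprob_algebra)
      show "subprob_space (\<sigma> n h)" "sets (\<sigma> n h) = sets borel" for h
        using Delta[of h] by (auto simp: Delta_iff prob_space_imp_subprob_space)
      have [measurable]: "(\<lambda>h. a_seq G e xl x0 h n) \<in> borel_measurable (history_space n)"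
        using seq_measurable[OF order_refl] by blast
      fix A :: "'i set"
      assume "A \<in> sets borel"
      then have eq: "emeasure (\<sigma> n h) A
          = ennreal (a_seq G e xl x0 h n) * emeasure xl A + ennreal (1 - a_seq G e xl x0 h n) * emeasure x0 A" for h
        unfolding sigma_star_def by (rule emeasure_convex_comb[OF a_nonneg a_le_1 xl x0])
      then show "(\<lambda>h. emeasure (\<sigma> n h) A) \<in> borel_measurable (history_space n)"
        unfolding eq by measurable
    qed
  qed
  then show ?thesis
    by (simp add: behavior_strategies_def)
qed

lemma gamma_T_sigma_star_ge:
  assumes \<tau>: "\<tau> \<in> behavior_strategies" and T: "256 / (lam ^ 4 * e ^ 12) \<le> real T"
  shows "- 8 * e \<le> gamma_T G T \<sigma> \<tau>"
proof -
  interpret bounded_play G \<sigma> \<tau>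
    by (rule bounded_playI[OF sigma_star_in_behavior \<tau>])
  let ?c = "\<lambda>t i j. ennreal (1 + pay G i j + real (T - 1 - t) * absorbing_gain i j)"
  let ?\<alpha> = "alpha_seq G e xl x0" and ?a = "a_seq G e xl x0"
  let ?q = "\<lambda>x h t. mixed_trans G (nonabs G) x (snd (h t))"
  have stay_eq: "stay_prob t (restrict h {0..<t}) (snd (h t))
      = ennreal (?a h t * ?q xl h t + (1 - ?a h t) * ?q x0 h t)" for t h
    unfolding stay_prob_def sigma_star_def a_seq_restrict
    using a_nonneg[of h t] a_le_1[of h t]
    by (simp add: nn_integral_convex_comb xl x0 trans_section nn_integral_trans ennreal_mult mixed_trans_nonneg)
  have survival_eq: "survival t h = ennreal (?\<alpha> h t)" for t h
    unfolding survival_def alpha_seq.simps[of _ _ _ _ _ t]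
    using survival_bounds(1) by (simp add: stay_eq prod_ennreal)
  \<comment> \<open>The shifted payoff at stage index t together with the shifted payoff of an
    absorption there over the remaining stages; the absorption probability 1 - q is the share of the
    shift.\<close>
  define W where "W h t x = 1 + mixed_pay G x (snd (h t)) + real (T - 1 - t) *
      (g_sharp G x (snd (h t)) + (1 - ?q x h t))"
    for h :: "nat \<Rightarrow> 'i \<times> 'j" and t x
  have W_nonneg: "0 \<le> W h t x" if "x \<in> Delta" for h t x
  proof -
    have "0 \<le> 1 + mixed_pay G x (snd (h t))" "0 \<le> g_sharp G x (snd (h t)) + (1 - ?q x h t)"
      using mixed_pay_abs_le[OF that, of "snd (h t)"] g_sharp_abs_le[OF that, of "snd (h t)"] by linarith+
    then show ?thesis
      by (simp add: W_def)
  qed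
  have c_eq: "(\<integral>\<^sup>+i. ?c t i (snd (h t)) \<partial>\<sigma> t (restrict h {0..<t}))
      = ennreal (?a h t * W h t xl + (1 - ?a h t) * W h t x0)" for t h
  proof -
    have "(\<lambda>i. ?c t i (snd (h t))) \<in> borel_measurable borel"
      using measurable_compose[OF _ absorbing_gain_measurable, of "\<lambda>i. (i, snd (h t))" borel]
        pay_section[of "snd (h t)"] by simp
    then show ?thesis
      unfolding sigma_star_def a_seq_restrict
      using a_nonneg[of h t] a_le_1[of h t] W_nonneg[OF xl, of h t] W_nonneg[OF x0, of h t]
      by (simp only: nn_integral_convex_comb[OF _ _ xl x0] nn_integral_gain[OF xl of_nat_0_le_iff]
          nn_integral_gain[OF x0 of_nat_0_le_iff] flip: W_def) (simp add: ennreal_mult)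
  qed
  have path: "ennreal (real T - 8 * e * real T) \<le>
      (\<Sum>t<T. survival t h * (\<integral>\<^sup>+i. ?c t i (snd (h t)) \<partial>\<sigma> t (restrict h {0..<t})))" for h
  proof -
    \<comment> \<open>The shift is separated from the true payoff. Its part counts the unabsorbed
      mass at the stage and the newly absorbed mass once per later stage, hence 1 per stage and T in
      total.\<close>
    have split: "?\<alpha> h t * (?a h t * W h t xl + (1 - ?a h t) * W h t x0) =
        (?\<alpha> h t + real (T - 1 - t) * (?\<alpha> h t - ?\<alpha> h (Suc t))) +
        ?\<alpha> h t * (?a h t * mixed_pay G xl (snd (h t)) + (1 - ?a h t) * g_flat G x0 (snd (h t))
          + real (T - 1 - t) * (?a h t * g_sharp G xl (snd (h t)) + (1 - ?a h t) * g_sharp G x0 (snd (h t))))" for t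
      unfolding \<alpha>_Suc W_def g_flat_def by (simp add: algebra_simps del: of_nat_diff)
    have "(\<Sum>t<T. real (T - 1 - t) * (?\<alpha> h t - ?\<alpha> h (Suc t))) = (\<Sum>t<T. \<Sum>s<t. ?\<alpha> h s - ?\<alpha> h (Suc s))"
      by (rule sum_weighted_eq_sum_partial_sums)
    also have "\<dots> = (\<Sum>t<T. 1 - ?\<alpha> h t)"
      by (simp add: sum_lessThan_telescope' alpha_seq.simps[of _ _ _ _ _ 0])
    finally have "(\<Sum>t<T. ?\<alpha> h t + real (T - 1 - t) * (?\<alpha> h t - ?\<alpha> h (Suc t))) = real T"
      by (simp add: sum.distrib sum_subtractf)
    then have "real T - 8 * e * real T \<le> (\<Sum>t<T. ?\<alpha> h t * (?a h t * W h t xl + (1 - ?a h t) * W h t x0))"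
      unfolding split sum.distrib[of _ _ "{..<T}"] using path_payoff_ge[OF T, of h] by linarith
    then have "ennreal (real T - 8 * e * real T)
        \<le> ennreal (\<Sum>t<T. ?\<alpha> h t * (?a h t * W h t xl + (1 - ?a h t) * W h t x0))"
      by (rule ennreal_leI)
    also have "\<dots> = (\<Sum>t<T. survival t h * (\<integral>\<^sup>+i. ?c t i (snd (h t)) \<partial>\<sigma> t (restrict h {0..<t})))"
      unfolding survival_eq c_eq
      using \<alpha>_bounds(1)[of h] a_nonneg[of h] a_le_1[of h] W_nonneg[OF xl, of h] W_nonneg[OF x0, of h]
      by (subst sum_ennreal[symmetric]) (auto simp: ennreal_mult)
    finally show ?thesis .
  qed
  have c: "(\<lambda>y. ?c t (fst y) (snd y)) \<in> borel_measurable (borel \<Otimes>\<^sub>M borel)" for t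
    using absorbing_gain_measurable by simp
  have "ennreal (real T - 8 * e * real T) \<le> ennreal (\<Sum>n<T. 1 + stage_value n)"
    unfolding sum_stage_value_eq by (rule live_sum_ge[OF c path])
  \<comment> \<open>For e > 1/8 the left side \<open>real T - 8 * e * real T\<close> is negative and
    \<open>ennreal\<close> truncates it to 0; nonnegativity of the right side lets the comparison
    return to the reals.\<close>
  moreover have "0 \<le> (\<Sum>n<T. 1 + stage_value n)"
    using stage_value_abs_le by (intro sum_nonneg) (smt (verit))
  ultimately have "real T - 8 * e * real T \<le> (\<Sum>n<T. 1 + stage_value n)"
    by (simp add: ennreal_le_iff)
  then have "- 8 * e * real T \<le> (\<Sum>n<T. stage_value n)"
    by (simp add: sum.distrib)
  moreover have "0 < real T"
    using T e lam by (smt (verit) divide_pos_pos mult_pos_pos zero_less_power)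
  ultimately show ?thesis
    by (simp add: gamma_T_eq pos_le_divide_eq)
qed

end

theorem theorem7p1:
  fixes G :: "('w::finite, 'i::topological_space, 'j::topological_space) absorbing_game"
    and \<epsilon> lam :: real
    and x :: "real \<Rightarrow> 'i measure"
    and x\<^sub>0 :: "'i measure"
    and l :: "nat \<Rightarrow> real"
  assumes "is_absorbing_game G"
    and "0 < \<epsilon>" and "\<epsilon> < 1 / 2"
    and "Limsup (at_right 0) (\<lambda>r. ereal (disc_value G r)) = ereal \<epsilon>"
    and "\<forall>i j. \<bar>pay G i j\<bar> \<le> 1"
    and "\<forall>w. \<bar>abs_pay G w\<bar> \<le> 1"
    and "\<forall>r. 0 < r \<and> r < 1 \<longrightarrow> optimal_stationary G r (x r)"
    and "\<forall>k. 0 < l k \<and> l k < 1"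
    and "l \<longlonglongrightarrow> 0"
    and "(\<lambda>k. disc_value G (l k)) \<longlonglongrightarrow> \<epsilon>"
    and "x\<^sub>0 \<in> Delta"
    and "weakly_converges (\<lambda>k. x (l k)) x\<^sub>0"
    and "0 < lam" and "lam < 1"
    and "\<forall>j. \<bar>mixed_pay G x\<^sub>0 j - mixed_pay G (x lam) j\<bar> \<le> \<epsilon> / 2"
    and "disc_value G lam \<ge> \<epsilon> / 2"
    and "\<exists>j. g_flat G x\<^sub>0 j < 0"
  shows "sigma_star G \<epsilon> (x lam) x\<^sub>0 \<in> behavior_strategies \<and>
         (\<forall>\<tau>\<in>behavior_strategies. \<forall>T::nat. real T \<ge> 256 / (lam ^ 4 * \<epsilon> ^ 12) \<longrightarrow>
            gamma_T G T (sigma_star G \<epsilon> (x lam) x\<^sub>0) \<tau> \<ge> - 8 * \<epsilon>)"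
proof -
  interpret bounded_game G
    using assms(1,5,6) by unfold_locales (auto simp: is_absorbing_game_def)
  have opt: "optimal_stationary G lam (x lam)"
    using assms(7,13,14) by blast
  then have xl: "x lam \<in> Delta"
    by (simp add: optimal_stationary_def)
  interpret regret_game G \<epsilon> lam "x lam" x\<^sub>0
  proof unfold_locales
    fix j
    let ?q = "\<lambda>x. mixed_trans G (nonabs G) x j"
    have q: "0 \<le> 1 - ?q (x lam)" "0 \<le> 1 - ?q x\<^sub>0"
      using mixed_trans_le_1[OF xl] mixed_trans_le_1[OF assms(11)] by auto
    \<comment> \<open>The surplus lam \<epsilon> / 2 coming from v_lam >= \<epsilon> / 2 is exactly
      what replacing x_lam by x0 in the stage payoff may cost.\<close>
    have "\<epsilon> / 2 * lam \<le> \<epsilon> / 2 * (lam + (1 - lam) * (1 - ?q (x lam)))"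
      using q assms by (intro mult_left_mono) auto
    also have "\<dots> \<le> disc_value G lam * (lam + (1 - lam) * (1 - ?q (x lam)))"
      using q assms by (intro mult_right_mono) auto
    also have "\<dots> \<le> lam * mixed_pay G (x lam) j + (1 - lam) * g_sharp G (x lam) j"
      by (rule optimal_stationary_ge[OF assms(13,14) opt])
    finally have *: "\<epsilon> / 2 * lam \<le> lam * mixed_pay G (x lam) j + (1 - lam) * g_sharp G (x lam) j" .
    have "lam * mixed_pay G (x lam) j \<le> lam * (g_flat G x\<^sub>0 j + \<epsilon> / 2)"
      using assms(13) assms(15)[rule_format, of j] unfolding g_flat_def by (intro mult_left_mono) linarith+
    with * show "0 \<le> (1 - lam) * g_sharp G (x lam) j + lam * g_flat G x\<^sub>0 j"
      by (simp add: algebra_simps)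
    \<comment> \<open>The limit of the discounted values is \<epsilon> > 0, so absorption under x0
      has nonnegative payoff against every j.\<close>
    have "0 \<le> \<epsilon> * (1 - ?q x\<^sub>0)"
      using q assms by simp
    also have "\<dots> \<le> g_sharp G x\<^sub>0 j"
      using assms(1,7,8) by (intro g_sharp_limit_ge[OF _ _ _ _ assms(9,10,12)]) (auto simp: is_absorbing_game_def)
    finally show "0 \<le> g_sharp G x\<^sub>0 j" .
  qed (use assms xl in auto)
  show ?thesis
    using sigma_star_in_behavior gamma_T_sigma_star_ge by auto
qed

end
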